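(* Let $m,n\ge 1$ and let $\mathcal{F}$ be a non-quadratic linear foliation of codimension $n$ on the torus $T^{m+n}$, with holonomy group $\Gamma\subset\mathbb{R}^n$. Then $\mathrm{Aut}_\Gamma(\mathbb{R}^n)=\{\pm\mathrm{id}\}$ and $\mathrm{Diff}(T^{m+n}/\mathcal{F})$ is isomorphic to $\mathbb{Z}_2\ltimes (T^{m+n}/\mathcal{F})$, where $T^{m+n}/\mathcal{F}$ is identified with the group $\mathbb{R}^n/\Gamma$ and $\mathbb{Z}_2=\{\pm\mathrm{id}\}$ acts on it by $\pm 1$.
   Context: Use coordinates $(x_1,\dots,x_m,y_1,\dots,y_n)$ on $\mathbb{R}^{m+n}$ and $T^{m+n}=\mathbb{R}^{m+n}/\mathbb{Z}^{m+n}$. A linear foliation of dimension $m$ and codimension $n$ on $T^{m+n}$ is the foliation induced by the translates of a linear subspace $V\subset\mathbb{R}^{m+n}$ of dimension $m$. The foliation is called non-quadratic if it can be defined as the kernel of an $\mathbb{R}^n$-valued closed $1$-form $\omega=(\omega_1,\dots,\omega_n)$ with $$\omega_j=dy_j+\beta_j^1dx_1+\cdots+\beta_j^m dx_m,\quad 1\le j\le n,$$ with real constants $\beta_j^i$, such that any (nonzero) polynomial in $mn$ variables with rational coefficients which annihilates the family $\{\beta_j^i\}$ has degree greater than $2$. For such an $\omega$, the holonomy group $\Gamma$ is its group of periods, $\Gamma=\langle e_1,\dots,e_n,\beta_1,\dots,\beta_m\rangle\subset\mathbb{R}^n$ (the subgroup generated), where $e_1,\dots,e_n$ is the canonical basis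 and $\beta_k=(\beta_1^k,\dots,\beta_n^k)$. $\mathrm{Aut}_\Gamma(\mathbb{R}^n)$ is the group of linear automorphisms $\varphi$ of $\mathbb{R}^n$ with $\varphi(\Gamma)=\Gamma$. The space of leaves $T^{m+n}/\mathcal{F}$ is endowed with the quotient diffeology (its plots are the maps $U\to T^{m+n}/\mathcal{F}$, $U$ open in some $\mathbb{R}^p$, which locally lift to $\mathcal{C}^\infty$ maps into $T^{m+n}$); it is diffeomorphic to $\mathbb{R}^n/\Gamma$ with its quotient diffeology (plots locally lift to $\mathcal{C}^\infty$ maps into $\mathbb{R}^n$). A map of diffeological spaces is differentiable if it carries plots to plots by composition, and $\mathrm{Diff}$ denotes the group of differentiable bijections with differentiable inverse. *)

theory Defs
  imports
    "HOL-Analysis.Analysis"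
    "HOL-Algebra.Bij"
    "HOL-Algebra.Generated_Groups"
    "HOL-Library.Poly_Mapping"
begin

subsection \<open>Diffeologies\<close>

text \<open>
  The domain of a plot is an open subset of \<open>\<real>\<^sup>p\<close> for an arbitrary natural number \<open>p\<close>.
  As \<open>p\<close> is quantified inside the definitions, \<open>\<real>\<^sup>p\<close> is the library's
  \<^const>\<open>Euclidean_space\<close>, whose points are the real sequences vanishing from index \<open>p\<close> on.
  A diffeology tells for which \<open>p\<close>, \<open>U\<close>, \<open>f\<close> the restriction of \<open>f\<close> to \<open>U\<close> is a plot; the
  values of \<open>f\<close> outside \<open>U\<close> are irrelevant.
\<close>

type_synonym 'a diffeology = "nat \<Rightarrow> (nat \<Rightarrow> real) set \<Rightarrow> ((nat \<Rightarrow> real) \<Rightarrow> 'a) \<Rightarrow> bool"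

text \<open>
  Class \<open>C\<^sup>k\<close> on an open subset \<open>U\<close> of \<open>\<real>\<^sup>p\<close>: the partial derivatives up to order \<open>k\<close> exist and
  are continuous. The family \<open>g\<close> consists of the first-order partial derivatives.
\<close>

primrec Ck_on :: "nat \<Rightarrow> nat \<Rightarrow> (nat \<Rightarrow> real) set \<Rightarrow> ((nat \<Rightarrow> real) \<Rightarrow> 'b::real_normed_vector) \<Rightarrow> bool"
where
  "Ck_on 0 p U f \<longleftrightarrow> continuous_on U f"
| "Ck_on (Suc k) p U f \<longleftrightarrow> continuous_on U f \<and>
     (\<exists>g. \<forall>i<p. (\<forall>x\<in>U. ((\<lambda>t. f (x(i := t))) has_vector_derivative g i x) (at (x i)))
              \<and> Ck_on k p U (g i))"

definition std_diffeology :: "'b::real_normed_vector diffeology" where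
  "std_diffeology p U f \<longleftrightarrow> openin (Euclidean_space p) U \<and> (\<forall>k. Ck_on k p U f)"

definition quotient_diffeology :: "'a diffeology \<Rightarrow> ('a \<Rightarrow> 'b) \<Rightarrow> 'b diffeology" where
  "quotient_diffeology D \<pi> p U f \<longleftrightarrow> openin (Euclidean_space p) U \<and>
     (\<forall>x\<in>U. \<exists>W g. openin (Euclidean_space p) W \<and> x \<in> W \<and> W \<subseteq> U \<and>
        D p W g \<and> (\<forall>w\<in>W. f w = \<pi> (g w)))"

definition differentiable_map ::
  "'a set \<Rightarrow> 'a diffeology \<Rightarrow> 'b set \<Rightarrow> 'b diffeology \<Rightarrow> ('a \<Rightarrow> 'b) \<Rightarrow> bool" where
  "differentiable_map X D Y E f \<longleftrightarrow>
     f \<in> X \<rightarrow> Y \<and> (\<forall>p U g. D p U g \<longrightarrow> E p U (f \<circ> g))"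

definition diffeomorphism ::
  "'a set \<Rightarrow> 'a diffeology \<Rightarrow> 'b set \<Rightarrow> 'b diffeology \<Rightarrow> ('a \<Rightarrow> 'b) \<Rightarrow> bool" where
  "diffeomorphism X D Y E f \<longleftrightarrow>
     bij_betw f X Y \<and> differentiable_map X D Y E f \<and> differentiable_map Y E X D (inv_into X f)"

definition Diff_group :: "'a set \<Rightarrow> 'a diffeology \<Rightarrow> ('a \<Rightarrow> 'a) monoid" where
  "Diff_group X D = BijGroup X \<lparr>carrier := {f \<in> Bij X. diffeomorphism X D X D f}\<rparr>"


subsection \<open>Groups\<close>

definition additive_group :: "'a::ab_group_add monoid" where
  "additive_group = \<lparr>carrier = UNIV, mult = (+), one = 0\<rparr>"

text \<open>
  \<open>K \<ltimes> N\<close> with multiplication \<open>(k, a) (l, b) = (k l, a (k \<cdot> b))\<close>, where \<open>K\<close> acts on \<open>N\<close> by \<open>act\<close>.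
\<close>

definition semidirect_product ::
  "('k, 'c) monoid_scheme \<Rightarrow> ('a, 'd) monoid_scheme \<Rightarrow> ('k \<Rightarrow> 'a \<Rightarrow> 'a) \<Rightarrow> ('k \<times> 'a) monoid" where
  "semidirect_product K N act =
     \<lparr>carrier = carrier K \<times> carrier N,
      mult = (\<lambda>(k, a) (l, b). (k \<otimes>\<^bsub>K\<^esub> l, a \<otimes>\<^bsub>N\<^esub> act k b)),
      one = (\<one>\<^bsub>K\<^esub>, \<one>\<^bsub>N\<^esub>)\<rparr>"

definition linear_aut_group :: "'a::real_vector set \<Rightarrow> ('a \<Rightarrow> 'a) monoid" where
  "linear_aut_group \<Gamma> = \<lparr>carrier = {\<phi>. linear \<phi> \<and> bij \<phi> \<and> \<phi> ` \<Gamma> = \<Gamma>}, mult = (\<circ>), one = id\<rparr>"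

definition sign_group :: "('a::real_vector \<Rightarrow> 'a) monoid" where
  "sign_group = \<lparr>carrier = {id, uminus}, mult = (\<circ>), one = id\<rparr>"


subsection \<open>Linear foliations of the torus\<close>

text \<open>
  \<open>\<real>\<^sup>m\<^sup>+\<^sup>n\<close> is \<open>real^'m \<times> real^'n\<close>, with points \<open>(x, y)\<close>. The smooth maps into the torus are those
  that locally lift to smooth maps into \<open>\<real>\<^sup>m\<^sup>+\<^sup>n\<close>, because the projection is a covering and a
  local diffeomorphism.
\<close>

definition int_lattice :: "((real^'m) \<times> (real^'n)) set" where
  "int_lattice = {(x, y). (\<forall>i. x $ i \<in> \<int>) \<and> (\<forall>j. y $ j \<in> \<int>)}"

definition torus :: "((real^'m) \<times> (real^'n)) set set" where
  "torus = carrier (additive_group Mod int_lattice)"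

definition torus_proj :: "(real^'m) \<times> (real^'n) \<Rightarrow> ((real^'m) \<times> (real^'n)) set" where
  "torus_proj z = int_lattice #>\<^bsub>additive_group\<^esub> z"

definition torus_diffeology :: "((real^'m) \<times> (real^'n)) set diffeology" where
  "torus_diffeology = quotient_diffeology std_diffeology torus_proj"

definition linear_foliation :: "((real^'m) \<times> (real^'n)) set \<Rightarrow> bool" where
  "linear_foliation V \<longleftrightarrow> subspace V \<and> dim V = CARD('m)"

text \<open>
  The leaf through a point \<open>P\<close> of the torus is the image of the translate \<open>z + V\<close>, for any
  representative \<open>z\<close> of \<open>P\<close>.
\<close>

definition leaf ::
  "((real^'m) \<times> (real^'n)) set \<Rightarrow> ((real^'m) \<times> (real^'n)) set \<Rightarrow> ((real^'m) \<times> (real^'n)) set set"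
where
  "leaf V P = {torus_proj (z + v) | z v. z \<in> P \<and> v \<in> V}"

definition leaf_space :: "((real^'m) \<times> (real^'n)) set \<Rightarrow> ((real^'m) \<times> (real^'n)) set set set" where
  "leaf_space V = leaf V ` torus"

definition leaf_space_diffeology ::
  "((real^'m) \<times> (real^'n)) set \<Rightarrow> ((real^'m) \<times> (real^'n)) set set diffeology" where
  "leaf_space_diffeology V = quotient_diffeology torus_diffeology (leaf V)"


subsection \<open>Non-quadratic foliations and their holonomy group\<close>

text \<open>
  Polynomials over \<open>\<rat>\<close> in variables indexed by \<open>'v\<close> are finitely supported maps from monomials
  to coefficients, a monomial being a finitely supported map from variables to exponents.
\<close>

type_synonym 'v rat_mpoly = "('v \<Rightarrow>\<^sub>0 nat) \<Rightarrow>\<^sub>0 rat"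

definition mpoly_eval :: "'v rat_mpoly \<Rightarrow> ('v \<Rightarrow> real) \<Rightarrow> real" where
  "mpoly_eval P a =
     (\<Sum>\<mu>\<in>Poly_Mapping.keys P. of_rat (Poly_Mapping.lookup P \<mu>) *
        (\<Prod>v\<in>Poly_Mapping.keys \<mu>. a v ^ Poly_Mapping.lookup \<mu> v))"

definition mpoly_degree :: "'v rat_mpoly \<Rightarrow> nat" where
  "mpoly_degree P =
     Max (insert 0 ((\<lambda>\<mu>. \<Sum>v\<in>Poly_Mapping.keys \<mu>. Poly_Mapping.lookup \<mu> v)
       ` Poly_Mapping.keys P))"

text \<open>The constants \<open>\<beta>\<^sub>j\<^sup>i\<close> form the matrix \<open>\<beta>\<close> with entries \<open>\<beta> $ j $ i\<close>.\<close>

definition nonquadratic_coeffs :: "real^'m^'n \<Rightarrow> bool" where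
  "nonquadratic_coeffs \<beta> \<longleftrightarrow>
     (\<forall>P :: ('n \<times> 'm) rat_mpoly.
        P \<noteq> 0 \<and> mpoly_eval P (\<lambda>(j, i). \<beta> $ j $ i) = 0 \<longrightarrow> mpoly_degree P > 2)"

text \<open>
  The constant-coefficient form \<open>\<omega>\<close>, as a linear map: its \<open>j\<close>-th component at \<open>(x, y)\<close> is
  \<open>y\<^sub>j + \<Sum>\<^sub>i \<beta>\<^sub>j\<^sup>i x\<^sub>i\<close>.
\<close>

definition foliation_form :: "real^'m^'n \<Rightarrow> (real^'m) \<times> (real^'n) \<Rightarrow> real^'n" where
  "foliation_form \<beta> z = (\<chi> j. snd z $ j + (\<Sum>i\<in>UNIV. \<beta> $ j $ i * fst z $ i))"

definition nonquadratic_form :: "real^'m^'n \<Rightarrow> ((real^'m) \<times> (real^'n)) set \<Rightarrow> bool" where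
  "nonquadratic_form \<beta> V \<longleftrightarrow> V = {z. foliation_form \<beta> z = 0} \<and> nonquadratic_coeffs \<beta>"

definition holonomy_group :: "real^'m^'n \<Rightarrow> (real^'n) set" where
  "holonomy_group \<beta> =
     generate additive_group ({axis j 1 | j. True} \<union> {column k \<beta> | k. True})"

definition holonomy_quotient :: "real^'m^'n \<Rightarrow> (real^'n) set monoid" where
  "holonomy_quotient \<beta> = additive_group Mod holonomy_group \<beta>"

definition holonomy_quotient_diffeology :: "real^'m^'n \<Rightarrow> (real^'n) set diffeology" where
  "holonomy_quotient_diffeology \<beta> =
     quotient_diffeology std_diffeology (\<lambda>y. holonomy_group \<beta> #>\<^bsub>additive_group\<^esub> y)"

text \<open>
  The identification of the leaf space with \<open>\<real>\<^sup>n / \<Gamma>\<close> induced by \<open>\<omega>\<close>. The union of a leaf (a set of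
  cosets) is its preimage \<open>z + V + \<int>\<^sup>m\<^sup>+\<^sup>n\<close> in \<open>\<real>\<^sup>m\<^sup>+\<^sup>n\<close>, which \<open>\<omega>\<close> maps onto the coset \<open>\<omega>(z) + \<Gamma>\<close>.
\<close>

definition leaf_identification ::
  "real^'m^'n \<Rightarrow> ((real^'m) \<times> (real^'n)) set set \<Rightarrow> (real^'n) set" where
  "leaf_identification \<beta> L = foliation_form \<beta> ` \<Union>L"

end

(* A linear map preserving Gamma sends the generators e_l and beta_k into Gamma, i.e. its matrix A
   is P + beta Q and A beta = R + beta S with integer matrices P, Q, R, S. Hence
   (P + beta Q) beta = R + beta S, which consists of integral quadratic relations between the entries
   of beta. As the foliation is non-quadratic, the same identity holds with beta replaced by any real
   matrix, and this forces Q = 0 and P = c id; so A is an integer scalar, and A = +-id when A^-1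
   preserves Gamma as well.

   A differentiable map f of R^n / Gamma lifts on a ball around 0 to a continuous map h. For gamma in
   Gamma the continuous function h(x + gamma) - h(x) takes values in the countable set Gamma, so it is
   constant. Since Gamma is dense (Kronecker's approximation theorem, applied to one column of beta),
   h - h(0) is additive near 0, hence linear, and by density again f is induced globally by an affine
   map x |-> A x + c with A Gamma contained in Gamma. If f is a diffeomorphism, the affine map inducing
   its inverse has a linear part that is inverse to A, and therefore A = +-id. *)

theory Submission
  imports Defs "HOL-Analysis.Kronecker_Approximation_Theorem"
begin

section \<open>Quadratic relations with integer coefficients\<close>

text \<open>Working with functions of the evaluation point lets a quadratic relation be recognised
  from its shape as a sum of monomials, without computing coefficients.\<close>

definition rat_quadratic :: "(('v::finite \<Rightarrow> real) \<Rightarrow> real) \<Rightarrow> bool" where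
  "rat_quadratic F \<longleftrightarrow> (\<exists>P :: 'v rat_mpoly. mpoly_degree P \<le> 2 \<and> F = mpoly_eval P)"

text \<open>A variable absent from a monomial contributes the factor 1, a monomial absent from
  \<open>P\<close> the summand 0. With index sets independent of \<open>P\<close>, evaluations can
  be added termwise.\<close>

lemma mpoly_eval_superset:
  fixes P :: "'v::finite rat_mpoly"
  assumes "finite S" "Poly_Mapping.keys P \<subseteq> S"
  shows "mpoly_eval P a = (\<Sum>\<mu>\<in>S. of_rat (Poly_Mapping.lookup P \<mu>) *
    (\<Prod>v\<in>UNIV. a v ^ Poly_Mapping.lookup \<mu> v))"
proof -
  have "(\<Prod>v\<in>Poly_Mapping.keys \<mu>. a v ^ Poly_Mapping.lookup \<mu> v)
      = (\<Prod>v\<in>UNIV. a v ^ Poly_Mapping.lookup \<mu> v)" for \<mu> :: "'v \<Rightarrow>\<^sub>0 nat"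
    by (rule prod.mono_neutral_left) (auto simp: in_keys_iff)
  then show ?thesis
    unfolding mpoly_eval_def using assms
    by (simp, intro sum.mono_neutral_left) (auto simp: in_keys_iff)
qed

lemma mpoly_degree_le_iff:
  fixes P :: "'v::finite rat_mpoly"
  shows "mpoly_degree P \<le> d \<longleftrightarrow>
    (\<forall>\<mu>\<in>Poly_Mapping.keys P. (\<Sum>v\<in>UNIV. Poly_Mapping.lookup \<mu> v) \<le> d)"
proof -
  have "(\<Sum>v\<in>Poly_Mapping.keys \<mu>. Poly_Mapping.lookup \<mu> v) = (\<Sum>v\<in>UNIV. Poly_Mapping.lookup \<mu> v)"
    for \<mu> :: "'v \<Rightarrow>\<^sub>0 nat"
    by (rule sum.mono_neutral_left) (auto simp: in_keys_iff)
  then show ?thesis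
    unfolding mpoly_degree_def by simp
qed

lemma mpoly_eval_add:
  fixes P Q :: "'v::finite rat_mpoly"
  shows "mpoly_eval (P + Q) a = mpoly_eval P a + mpoly_eval Q a"
proof -
  let ?S = "Poly_Mapping.keys P \<union> Poly_Mapping.keys Q"
  have "finite ?S" by simp
  then show ?thesis
    by (simp add: mpoly_eval_superset[of ?S] Poly_Mapping.keys_add lookup_add of_rat_add
        distrib_right sum.distrib)
qed

lemma rat_quadratic_add:
  assumes "rat_quadratic F" "rat_quadratic G"
  shows "rat_quadratic (\<lambda>X. F X + G X)"
proof -
  obtain P Q where "mpoly_degree P \<le> 2" "F = mpoly_eval P" "mpoly_degree Q \<le> 2" "G = mpoly_eval Q"
    using assms unfolding rat_quadratic_def by blast
  then show ?thesis
    unfolding rat_quadratic_def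
    by (intro exI[of _ "P + Q"])
       (use Poly_Mapping.keys_add[of P Q] in \<open>auto simp: mpoly_degree_le_iff mpoly_eval_add fun_eq_iff\<close>)
qed

lemma rat_quadratic_monomial:
  assumes "(\<Sum>v\<in>UNIV. Poly_Mapping.lookup \<mu> v) \<le> 2"
  shows "rat_quadratic (\<lambda>X. of_int c * (\<Prod>v\<in>UNIV. X v ^ Poly_Mapping.lookup \<mu> v))"
  unfolding rat_quadratic_def
proof (intro exI conjI)
  let ?P = "Poly_Mapping.single \<mu> (of_int c :: rat)"
  show "mpoly_degree ?P \<le> 2"
    using assms by (auto simp: mpoly_degree_le_iff split: if_splits)
  show "(\<lambda>X. of_int c * (\<Prod>v\<in>UNIV. X v ^ Poly_Mapping.lookup \<mu> v)) = mpoly_eval ?P"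
    by (simp add: fun_eq_iff mpoly_eval_superset[of "{\<mu>}"])
qed

lemma rat_quadratic_const: "rat_quadratic (\<lambda>X. of_int c)"
  using rat_quadratic_monomial[of 0 c] by simp

lemma rat_quadratic_linear: "rat_quadratic (\<lambda>X. of_int c * X u)"
  using rat_quadratic_monomial[of "Poly_Mapping.single u 1" c]
  by (simp add: lookup_single when_def if_distrib[where f="\<lambda>k. _ ^ k"] cong: if_cong)

text \<open>For \<open>u = v\<close> the two exponents add up to 2, so squares are covered as
  well.\<close>

lemma rat_quadratic_product: "rat_quadratic (\<lambda>X. of_int c * (X u * X v))"
  using rat_quadratic_monomial[of "Poly_Mapping.single u 1 + Poly_Mapping.single v 1" c]
  by (simp add: lookup_add lookup_single when_def power_add sum.distrib prod.distrib
      if_distrib[where f="\<lambda>k. _ ^ k"] cong: if_cong)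

lemma rat_quadratic_sum:
  assumes "\<And>t. t \<in> T \<Longrightarrow> rat_quadratic (F t)"
  shows "rat_quadratic (\<lambda>X. \<Sum>t\<in>T. F t X)"
  using assms
proof (induction T rule: infinite_finite_induct)
  case (insert t T)
  then show ?case by (simp add: rat_quadratic_add)
qed (use rat_quadratic_const[of 0] in simp_all)

text \<open>A polynomial of degree at most 2 vanishing at \<beta> is the zero polynomial. One
  relation satisfied by \<beta> thus becomes an identity open to substitution.\<close>

lemma nonquadratic_vanishing:
  assumes "nonquadratic_coeffs \<beta>" "rat_quadratic F" "F (\<lambda>(j, i). \<beta> $ j $ i) = 0"
  shows "F X = 0"
proof -
  obtain P where P: "mpoly_degree P \<le> 2" "F = mpoly_eval P"
    using assms(2) unfolding rat_quadratic_def by blast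
  then have "P = 0"
    using assms(1,3) unfolding nonquadratic_coeffs_def by (metis not_less)
  then show ?thesis
    using P by (simp add: mpoly_eval_def)
qed

text \<open>The relation is the (j, k) entry of (P + \<beta>Q)\<beta> = R + \<beta>S, where all four
  integer matrices are stored transposed. It persists for every matrix X in place of \<beta>, and
  matrices X with at most one nonzero entry isolate the coefficients.\<close>

lemma nonquadratic_relation:
  fixes \<beta> :: "real^'m^'n" and P :: "'n \<Rightarrow> 'n \<Rightarrow> int" and Q :: "'n \<Rightarrow> 'm \<Rightarrow> int"
    and R :: "'m \<Rightarrow> 'n \<Rightarrow> int" and S :: "'m \<Rightarrow> 'm \<Rightarrow> int"
  assumes "nonquadratic_coeffs \<beta>"
    and rel: "\<And>j k. (\<Sum>l\<in>UNIV. \<beta> $ l $ k * (of_int (P l j) + (\<Sum>i\<in>UNIV. \<beta> $ j $ i * of_int (Q l i))))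
      = of_int (R k j) + (\<Sum>i\<in>UNIV. \<beta> $ j $ i * of_int (S k i))"
  obtains c where "\<And>l j. P l j = (if j = l then c else 0)" "\<And>l i. Q l i = 0"
proof -
  have gen: "(\<Sum>l\<in>UNIV. X (l, k) * (of_int (P l j) + (\<Sum>i\<in>UNIV. X (j, i) * of_int (Q l i))))
      = of_int (R k j) + (\<Sum>i\<in>UNIV. X (j, i) * of_int (S k i))" for j k and X :: "'n \<times> 'm \<Rightarrow> real"
  proof -
    \<comment> \<open>\<open>F\<close> is the difference of the two sides, expanded into monomials
      so that the closure rules apply.\<close>
    define F :: "('n \<times> 'm \<Rightarrow> real) \<Rightarrow> real" where
      "F X = (\<Sum>l\<in>UNIV. of_int (P l j) * X (l, k)) +
        ((\<Sum>l\<in>UNIV. \<Sum>i\<in>UNIV. of_int (Q l i) * (X (l, k) * X (j, i))) +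
        (of_int (- R k j) + (\<Sum>i\<in>UNIV. of_int (- S k i) * X (j, i))))" for X
    have F: "F X = (\<Sum>l\<in>UNIV. X (l, k) * (of_int (P l j) + (\<Sum>i\<in>UNIV. X (j, i) * of_int (Q l i))))
      - (of_int (R k j) + (\<Sum>i\<in>UNIV. X (j, i) * of_int (S k i)))" for X
      unfolding F_def
      by (simp add: algebra_simps sum.distrib sum_distrib_left sum_negf)
    have "rat_quadratic F"
      unfolding F_def
      by (intro rat_quadratic_add rat_quadratic_sum rat_quadratic_const rat_quadratic_linear
          rat_quadratic_product)
    moreover have "F (\<lambda>(j, i). \<beta> $ j $ i) = 0"
      unfolding F using rel by simp
    ultimately show ?thesis
      using nonquadratic_vanishing[OF assms(1), of F X] F by simp
  qed
  have R0: "R k j = 0" for k j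
    using gen[of "\<lambda>_. 0" k j] by simp
  have delta_sum: "(\<Sum>a\<in>UNIV. (if a = b then t else 0) * g a) = t * g b"
    for b :: "'c::finite" and g :: "'c \<Rightarrow> real" and t
    by (simp add: if_distrib[where f="\<lambda>x. x * _"] cong: if_cong)
  \<comment> \<open>Here X has the single nonzero entry \<open>t\<close>, at position (l, i); the
    relation with \<open>k = i\<close> is divided by \<open>t\<close>.\<close>
  have E: "of_int (P l j) + (if j = l then t * of_int (Q l i) else 0) =
      (if j = l then of_int (S i i) else (0::real))" if "t \<noteq> 0" for l j i t
  proof -
    have "(\<Sum>a\<in>UNIV. (if a = l then t else 0) * (of_int (P a j) +
        (\<Sum>b\<in>UNIV. (if j = l \<and> b = i then t else 0) * of_int (Q a b)))) =
        (\<Sum>b\<in>UNIV. (if j = l \<and> b = i then t else 0) * (of_int (S i b) :: real))"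
      using gen[of "\<lambda>(a, b). if a = l \<and> b = i then t else 0" i j] by (simp add: R0)
    then show ?thesis
      using that by (cases "j = l") (simp_all add: delta_sum)
  qed
  \<comment> \<open>Comparing t = 1 with t = -1 separates the coefficient of t from the constant
    term.\<close>
  have Q0: "Q l i = 0" for l i
    using E[of 1 l l i] E[of "-1" l l i] by simp
  have PS: "P l l = S i i" for l i
    using E[of 1 l l i] by (simp add: Q0)
  have P0: "P l j = 0" if "j \<noteq> l" for l j
    using E[of 1 l j] that by simp
  show ?thesis
    \<comment> \<open>Every \<open>P l l\<close> equals every \<open>S i i\<close>, so the common
      value can be read off at an arbitrary index.\<close>
    by (rule that[of "S undefined undefined"]) (auto simp: P0 PS Q0)
qed

section \<open>Subgroups of additive groups and the holonomy group\<close>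

lemma comm_group_additive_group: "comm_group additive_group"
  by (rule comm_groupI) (auto simp: additive_group_def intro!: exI[of _ "- x" for x])

lemma additive_group_simps [simp]:
  "carrier additive_group = UNIV" "x \<otimes>\<^bsub>additive_group\<^esub> y = x + y" "\<one>\<^bsub>additive_group\<^esub> = 0"
  by (simp_all add: additive_group_def)

lemma inv_additive_group [simp]: "inv\<^bsub>additive_group\<^esub> x = - x"
proof -
  interpret comm_group additive_group by (rule comm_group_additive_group)
  show ?thesis by (rule inv_equality) simp_all
qed

lemma additive_subgroup_iff:
  "subgroup H additive_group \<longleftrightarrow>
    0 \<in> H \<and> (\<forall>x\<in>H. \<forall>y\<in>H. x + y \<in> H) \<and> (\<forall>x\<in>H. - x \<in> H)"
  by (auto simp: subgroup_def)

lemma additive_subgroup_diff: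
  "\<lbrakk>subgroup H additive_group; x \<in> H; y \<in> H\<rbrakk> \<Longrightarrow> x - y \<in> H"
  unfolding additive_subgroup_iff diff_conv_add_uminus by blast

lemma additive_subgroup_diff_cancel:
  "\<lbrakk>subgroup H additive_group; x - y \<in> H; y \<in> H\<rbrakk> \<Longrightarrow> x \<in> H"
  unfolding additive_subgroup_iff by (metis diff_add_cancel)

lemma additive_subgroup_sum:
  "\<lbrakk>subgroup H additive_group; \<And>t. t \<in> T \<Longrightarrow> f t \<in> H\<rbrakk> \<Longrightarrow> sum f T \<in> H"
  by (induction T rule: infinite_finite_induct) (auto simp: additive_subgroup_iff)

lemma additive_subgroup_scale_int:
  fixes H :: "'a::real_vector set"
  assumes "subgroup H additive_group" "x \<in> H"
  shows "of_int c *\<^sub>R x \<in> H"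
proof -
  have nat: "of_nat k *\<^sub>R x \<in> H" for k
    by (induction k) (use assms in \<open>auto simp: additive_subgroup_iff scaleR_add_left\<close>)
  show ?thesis
  proof (cases c rule: int_cases2)
    case (nonneg k)
    then show ?thesis using nat[of k] by simp
  next
    case (nonpos k)
    then show ?thesis using nat[of k] assms(1) by (simp add: additive_subgroup_iff)
  qed
qed

lemma additive_coset: "H #>\<^bsub>additive_group\<^esub> x = (\<lambda>h. h + x) ` H"
  by (auto simp: r_coset_def)

lemma mem_additive_coset:
  "y \<in> H #>\<^bsub>additive_group\<^esub> x \<longleftrightarrow> y - x \<in> H"
proof
  assume "y - x \<in> H"
  then show "y \<in> H #>\<^bsub>additive_group\<^esub> x"
    unfolding additive_coset by (intro image_eqI[of _ _ "y - x"]) simp_all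
qed (auto simp: additive_coset)

lemma additive_coset_eq_iff:
  assumes "subgroup H additive_group"
  shows "H #>\<^bsub>additive_group\<^esub> x = H #>\<^bsub>additive_group\<^esub> y \<longleftrightarrow> x - y \<in> H"
proof
  assume "H #>\<^bsub>additive_group\<^esub> x = H #>\<^bsub>additive_group\<^esub> y"
  moreover have "x \<in> H #>\<^bsub>additive_group\<^esub> x"
    using assms by (simp add: mem_additive_coset additive_subgroup_iff)
  ultimately show "x - y \<in> H"
    by (simp add: mem_additive_coset)
next
  assume xy: "x - y \<in> H"
  have "z - x \<in> H \<longleftrightarrow> z - y \<in> H" for z
  proof
    assume "z - x \<in> H"
    then have "(z - x) + (x - y) \<in> H" using assms xy unfolding additive_subgroup_iff by blast
    then show "z - y \<in> H" by simp
  next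
    assume "z - y \<in> H"
    then have "(z - y) - (x - y) \<in> H" using additive_subgroup_diff[OF assms] xy by blast
    then show "z - x \<in> H" by simp
  qed
  then show "H #>\<^bsub>additive_group\<^esub> x = H #>\<^bsub>additive_group\<^esub> y"
    by (auto simp: mem_additive_coset)
qed

lemma set_mult_additive_coset:
  assumes "subgroup H additive_group"
  shows "(H #>\<^bsub>additive_group\<^esub> x) <#>\<^bsub>additive_group\<^esub> (H #>\<^bsub>additive_group\<^esub> y)
    = H #>\<^bsub>additive_group\<^esub> (x + y)"
proof -
  interpret comm_group additive_group by (rule comm_group_additive_group)
  have "H \<lhd> additive_group"
    using assms by (rule subgroup_imp_normal)
  then show ?thesis
    using normal.rcos_sum[of H additive_group x y] by simp
qed

section \<open>The form \<omega>, the integer lattice and the group of periods\<close>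

lemma foliation_form_alt: "foliation_form \<beta> (x, y) = y + \<beta> *v x"
  by (simp add: foliation_form_def vec_eq_iff matrix_vector_mult_def)

lemma linear_foliation_form: "linear (foliation_form \<beta>)"
  by (rule linearI)
    (simp_all add: foliation_form_def vec_eq_iff algebra_simps sum.distrib sum_distrib_left)

lemma subgroup_int_lattice: "subgroup int_lattice additive_group"
  by (auto simp: additive_subgroup_iff int_lattice_def zero_prod_def)

lemma matrix_vector_mult_columns: "(\<beta> :: real^'m^'n) *v x = (\<Sum>k\<in>UNIV. (x $ k) *\<^sub>R column k \<beta>)"
  by (simp add: vec_eq_iff matrix_vector_mult_def column_def mult.commute)

lemma vector_axis_expansion: "(y :: real^'n) = (\<Sum>j\<in>UNIV. (y $ j) *\<^sub>R axis j 1)"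
  using basis_expansion[of y] by (simp add: scalar_mult_eq_scaleR)

lemma subgroup_holonomy_group: "subgroup (holonomy_group \<beta>) additive_group"
  for \<beta> :: "real^'m^'n"
proof -
  interpret comm_group "additive_group :: (real^'n) monoid" by (rule comm_group_additive_group)
  show ?thesis
    unfolding holonomy_group_def by (rule generate_is_subgroup) simp
qed

lemma axis_in_holonomy_group: "axis j 1 \<in> holonomy_group \<beta>"
  unfolding holonomy_group_def by (blast intro: generate.incl)

lemma column_in_holonomy_group: "column k \<beta> \<in> holonomy_group \<beta>"
  unfolding holonomy_group_def by (blast intro: generate.incl)

text \<open>\<omega> sends the unit vectors of the lattice to the generators of \<Gamma>, so its
  image is a subgroup containing them. Conversely, \<omega> of an integer point is an integer
  combination of the generators.\<close>

lemma holonomy_group_eq: "holonomy_group \<beta> = foliation_form \<beta> ` int_lattice"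
  for \<beta> :: "real^'m^'n"
proof
  interpret comm_group "additive_group :: (real^'n) monoid" by (rule comm_group_additive_group)
  interpret \<omega>: linear "foliation_form \<beta>" by (rule linear_foliation_form)
  have "subgroup (foliation_form \<beta> ` int_lattice) additive_group"
    unfolding additive_subgroup_iff
  proof (intro conjI ballI)
    note L = subgroup_int_lattice[unfolded additive_subgroup_iff]
    show "0 \<in> foliation_form \<beta> ` int_lattice"
      by (rule image_eqI[of _ _ 0]) (simp_all add: L)
    fix u assume "u \<in> foliation_form \<beta> ` int_lattice"
    then obtain z where z: "u = foliation_form \<beta> z" "z \<in> int_lattice" by blast
    then show "- u \<in> foliation_form \<beta> ` int_lattice"
      by (intro image_eqI[of _ _ "- z"]) (simp_all add: L \<omega>.neg)
    fix v assume "v \<in> foliation_form \<beta> ` int_lattice"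
    then obtain w where w: "v = foliation_form \<beta> w" "w \<in> int_lattice" by blast
    show "u + v \<in> foliation_form \<beta> ` int_lattice"
      by (rule image_eqI[of _ _ "z + w"]) (simp_all add: L \<omega>.add z w)
  qed
  moreover have "{axis j 1 | j. True} \<union> {column k \<beta> | k. True} \<subseteq> foliation_form \<beta> ` int_lattice"
  proof -
    have "axis j 1 = foliation_form \<beta> (0, axis j 1)" "(0, axis j 1) \<in> int_lattice" for j
      by (simp_all add: foliation_form_alt int_lattice_def axis_def)
    moreover have "column k \<beta> = foliation_form \<beta> (axis k 1, 0)" "(axis k 1, 0) \<in> int_lattice" for k
      by (simp_all add: foliation_form_alt int_lattice_def axis_def matrix_vector_mult_columns
          if_distrib[where f="\<lambda>c. c *\<^sub>R _"] cong: if_cong)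
    ultimately show ?thesis by blast
  qed
  ultimately show "holonomy_group \<beta> \<subseteq> foliation_form \<beta> ` int_lattice"
    unfolding holonomy_group_def by (intro generate_subgroup_incl)
next
  note sub = subgroup_holonomy_group[of \<beta>]
  note gens = axis_in_holonomy_group column_in_holonomy_group
  show "foliation_form \<beta> ` int_lattice \<subseteq> holonomy_group \<beta>"
  proof clarify
    fix x :: "real^'m" and y :: "real^'n"
    assume "(x, y) \<in> int_lattice"
    then have int: "x $ i \<in> \<int>" "y $ j \<in> \<int>" for i j
      by (auto simp: int_lattice_def)
    have "(y $ j) *\<^sub>R axis j 1 \<in> holonomy_group \<beta>" for j
      using int(2)[of j] additive_subgroup_scale_int[OF sub gens(1)] by (auto elim!: Ints_cases)
    then have "(\<Sum>j\<in>UNIV. (y $ j) *\<^sub>R axis j 1) \<in> holonomy_group \<beta>"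
      by (rule additive_subgroup_sum[OF sub])
    moreover have "(x $ k) *\<^sub>R column k \<beta> \<in> holonomy_group \<beta>" for k
      using int(1)[of k] additive_subgroup_scale_int[OF sub gens(2)] by (auto elim!: Ints_cases)
    then have "(\<Sum>k\<in>UNIV. (x $ k) *\<^sub>R column k \<beta>) \<in> holonomy_group \<beta>"
      by (rule additive_subgroup_sum[OF sub])
    ultimately show "foliation_form \<beta> (x, y) \<in> holonomy_group \<beta>"
      using sub by (simp add: foliation_form_alt matrix_vector_mult_columns additive_subgroup_iff
          flip: vector_axis_expansion)
  qed
qed

lemma countable_holonomy_group: "countable (holonomy_group (\<beta> :: real^'m^'n))"
proof -
  let ?v = "\<lambda>z. \<chi> i. real_of_int (z $ i)"
  have "(x, y) \<in> (\<lambda>(a, b). (?v a, ?v b)) ` (UNIV :: ((int^'m) \<times> (int^'n)) set)"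
    if "(x, y) \<in> int_lattice" for x :: "real^'m" and y :: "real^'n"
    using that
    by (intro image_eqI[of _ _ "(\<chi> i. \<lfloor>x $ i\<rfloor>, \<chi> j. \<lfloor>y $ j\<rfloor>)"])
       (auto simp: int_lattice_def vec_eq_iff)
  then have "int_lattice \<subseteq> (\<lambda>(a, b). (?v a, ?v b)) ` (UNIV :: ((int^'m) \<times> (int^'n)) set)"
    by auto
  then have "countable (int_lattice :: ((real^'m) \<times> (real^'n)) set)"
    by (rule countable_subset) auto
  then show ?thesis
    by (simp add: holonomy_group_eq)
qed

text \<open>This is the form in which integer matrices are extracted from the images of the
  generators.\<close>

lemma holonomy_group_mem_iff:
  "v \<in> holonomy_group \<beta> \<longleftrightarrow>
    (\<exists>(x :: 'm \<Rightarrow> int) (y :: 'n \<Rightarrow> int). \<forall>j. v $ j = of_int (y j) + (\<Sum>i\<in>UNIV. \<beta> $ j $ i * of_int (x i)))"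
  for \<beta> :: "real^'m^'n"
proof
  assume "v \<in> holonomy_group \<beta>"
  then obtain a b where ab: "(a, b) \<in> int_lattice" "v = foliation_form \<beta> (a, b)"
    by (auto simp: holonomy_group_eq)
  then have "a $ i = of_int \<lfloor>a $ i\<rfloor>" "b $ j = of_int \<lfloor>b $ j\<rfloor>" for i j
    by (auto simp: int_lattice_def)
  then have "v $ j = of_int \<lfloor>b $ j\<rfloor> + (\<Sum>i\<in>UNIV. \<beta> $ j $ i * of_int \<lfloor>a $ i\<rfloor>)" for j
    using ab(2) by (simp add: foliation_form_def)
  then show "\<exists>(x :: 'm \<Rightarrow> int) (y :: 'n \<Rightarrow> int).
      \<forall>j. v $ j = of_int (y j) + (\<Sum>i\<in>UNIV. \<beta> $ j $ i * of_int (x i))"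
    by (intro exI[of _ "\<lambda>i. \<lfloor>a $ i\<rfloor>"] exI[of _ "\<lambda>j. \<lfloor>b $ j\<rfloor>"]) blast
next
  assume "\<exists>(x :: 'm \<Rightarrow> int) (y :: 'n \<Rightarrow> int).
      \<forall>j. v $ j = of_int (y j) + (\<Sum>i\<in>UNIV. \<beta> $ j $ i * of_int (x i))"
  then obtain x :: "'m \<Rightarrow> int" and y :: "'n \<Rightarrow> int"
    where v: "\<And>j. v $ j = of_int (y j) + (\<Sum>i\<in>UNIV. \<beta> $ j $ i * of_int (x i))" by blast
  then have "v = foliation_form \<beta> (\<chi> i. of_int (x i), \<chi> j. of_int (y j))"
    by (simp add: vec_eq_iff foliation_form_def)
  then show "v \<in> holonomy_group \<beta>"
    unfolding holonomy_group_eq by (auto simp: int_lattice_def)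
qed

section \<open>Linear maps preserving \<Gamma>\<close>

text \<open>The integer coefficients of the images of the generators satisfy the quadratic matrix
  relation. Assuming an inclusion rather than an equality makes the result applicable to linear
  parts of lifts.\<close>

lemma holonomy_endomorphism_scalar:
  fixes \<phi> :: "real^'n \<Rightarrow> real^'n" and \<beta> :: "real^'m^'n"
  assumes "nonquadratic_coeffs \<beta>" "linear \<phi>" and sub: "\<phi> ` holonomy_group \<beta> \<subseteq> holonomy_group \<beta>"
  obtains c :: int where "\<phi> = (\<lambda>v. of_int c *\<^sub>R v)"
proof -
  interpret \<phi>: linear \<phi> by fact
  note gens = axis_in_holonomy_group column_in_holonomy_group
  have "\<phi> (axis l 1) \<in> holonomy_group \<beta>" for l
    using gens(1) sub by blast
  then obtain Q P where PQ: "\<And>l j. \<phi> (axis l 1) $ j = of_int (P l j) + (\<Sum>i\<in>UNIV. \<beta> $ j $ i * of_int (Q l i))"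
    unfolding holonomy_group_mem_iff by metis
  have "\<phi> (column k \<beta>) \<in> holonomy_group \<beta>" for k
    using gens(2) sub by blast
  then obtain S R where RS: "\<And>k j. \<phi> (column k \<beta>) $ j = of_int (R k j) + (\<Sum>i\<in>UNIV. \<beta> $ j $ i * of_int (S k i))"
    unfolding holonomy_group_mem_iff by metis
  have exp: "\<phi> v $ j = (\<Sum>l\<in>UNIV. v $ l * \<phi> (axis l 1) $ j)" for v j
  proof -
    have "\<phi> v = \<phi> (\<Sum>l\<in>UNIV. (v $ l) *\<^sub>R axis l 1)"
      by (simp flip: vector_axis_expansion)
    then show ?thesis by (simp add: \<phi>.sum \<phi>.scale)
  qed
  \<comment> \<open>The image of the k-th column is computed twice: through the canonical basis, and
    as an element of \<Gamma>.\<close>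
  have "(\<Sum>l\<in>UNIV. \<beta> $ l $ k * (of_int (P l j) + (\<Sum>i\<in>UNIV. \<beta> $ j $ i * of_int (Q l i))))
      = of_int (R k j) + (\<Sum>i\<in>UNIV. \<beta> $ j $ i * of_int (S k i))" for j k
    using exp[of "column k \<beta>" j] unfolding RS PQ by (simp add: column_def)
  then obtain c where c: "\<And>l j. P l j = (if j = l then c else 0)" "\<And>l i. Q l i = 0"
    by (rule nonquadratic_relation[OF assms(1)]) blast
  have "\<phi> (axis l 1) $ j = (if j = l then of_int c else 0)" for l j
    by (simp add: PQ c)
  then have "\<phi> v $ j = of_int c * v $ j" for v j
    unfolding exp[of v] by (simp add: if_distrib[where f="\<lambda>x. _ * x"] mult.commute cong: if_cong)
  then have "\<phi> v = of_int c *\<^sub>R v" for v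
    by (simp add: vec_eq_iff)
  then show ?thesis using that by blast
qed

text \<open>Both maps are integer scalars with product 1, hence units of the integers.\<close>

lemma linear_inverse_pair_sign:
  fixes \<phi> \<psi> :: "real^'n \<Rightarrow> real^'n" and \<beta> :: "real^'m^'n"
  assumes "nonquadratic_coeffs \<beta>" "linear \<phi>" "linear \<psi>"
    and "\<phi> ` holonomy_group \<beta> \<subseteq> holonomy_group \<beta>" "\<psi> ` holonomy_group \<beta> \<subseteq> holonomy_group \<beta>"
    and inv: "\<And>v. \<phi> (\<psi> v) = v"
  shows "\<phi> = id \<or> \<phi> = uminus"
proof -
  obtain c d :: int where c: "\<phi> = (\<lambda>v. of_int c *\<^sub>R v)" and d: "\<psi> = (\<lambda>v. of_int d *\<^sub>R v)"
    using holonomy_endomorphism_scalar assms by metis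
  have "real_of_int (c * d) = 1"
    using inv[of "\<chi> i. 1"] by (simp add: c d vec_eq_iff)
  then have "c * d = 1"
    by (simp only: of_int_eq_1_iff)
  then have "c = 1 \<or> c = -1"
    by (auto simp: zmult_eq_1_iff)
  then show ?thesis by (auto simp: c fun_eq_iff)
qed

lemma linear_aut_holonomy_group:
  fixes \<beta> :: "real^'m^'n"
  assumes "nonquadratic_coeffs \<beta>"
  shows "carrier (linear_aut_group (holonomy_group \<beta>)) = {id, uminus}"
proof -
  let ?\<Gamma> = "holonomy_group \<beta>"
  have "uminus ` ?\<Gamma> = ?\<Gamma>"
  proof -
    have "v \<in> uminus ` ?\<Gamma> \<longleftrightarrow> v \<in> ?\<Gamma>" for v
      using subgroup_holonomy_group[of \<beta>] unfolding additive_subgroup_iff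
      by (metis image_iff minus_minus)
    then show ?thesis by blast
  qed
  moreover have "\<phi> = id \<or> \<phi> = uminus" if "linear \<phi>" "bij \<phi>" "\<phi> ` ?\<Gamma> = ?\<Gamma>" for \<phi>
  proof (rule linear_inverse_pair_sign[OF assms])
    interpret linear \<phi> by fact
    show "linear (inv_into UNIV \<phi>)"
      by (rule linearI; rule inv_f_eq)
        (use that(2) in \<open>simp_all add: add scale bij_is_inj bij_is_surj surj_f_inv_f\<close>)
    show "inv_into UNIV \<phi> ` ?\<Gamma> \<subseteq> ?\<Gamma>"
      using that(2,3) by (metis bij_is_inj image_inv_f_f order_refl)
    show "\<phi> (inv_into UNIV \<phi> v) = v" for v
      using that(2) by (simp add: bij_is_surj surj_f_inv_f)
  qed (use that in auto)
  ultimately show ?thesis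
    by (auto simp: linear_aut_group_def linear_uminus bij_uminus module_hom_id linear_id)
qed

section \<open>Density of \<Gamma>\<close>

text \<open>An affine relation has degree at most 2, so it holds at every point; the zero matrix and
  the matrices with one entry 1 then yield the coefficients. This is linear independence over the
  integers of 1 and the entries of a column.\<close>

lemma nonquadratic_affine_relation:
  fixes \<beta> :: "real^'m^'n" and a :: "'n \<Rightarrow> int"
  assumes "nonquadratic_coeffs \<beta>"
    and "(\<Sum>j\<in>UNIV. of_int (a j) * \<beta> $ j $ k) + of_int b = 0"
  shows "a j = 0" "b = 0"
proof -
  define F where "F X = (\<Sum>j\<in>UNIV. of_int (a j) * X (j, k)) + (of_int b :: real)" for X :: "'n \<times> 'm \<Rightarrow> real"
  have "rat_quadratic F"
    unfolding F_def by (intro rat_quadratic_add rat_quadratic_sum rat_quadratic_const rat_quadratic_linear)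
  then have F0: "F X = 0" for X
    by (rule nonquadratic_vanishing[OF assms(1)]) (use assms(2) in \<open>simp add: F_def\<close>)
  show "b = 0"
    using F0[of "\<lambda>_. 0"] by (simp add: F_def)
  then show "a j = 0"
    using F0[of "\<lambda>v. if v = (j, k) then 1 else 0"]
    by (simp add: F_def if_distrib[where f="\<lambda>x. _ * x"] cong: if_cong)
qed

text \<open>Kronecker's theorem and the domains of plots are indexed by natural numbers, vectors by
  a finite type; this numbering passes between the two.\<close>

lemma finite_type_enumeration:
  obtains e :: "nat \<Rightarrow> 'a::finite" and e'
  where "\<And>a. e' a < CARD('a)" "\<And>a. e (e' a) = a" "\<And>i. i < CARD('a) \<Longrightarrow> e' (e i) = i"
proof -
  obtain e where e: "bij_betw e {..<CARD('a)} (UNIV :: 'a set)"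
    using ex_bij_betw_nat_finite[of "UNIV :: 'a set"] by (auto simp: atLeast0LessThan)
  show ?thesis
  proof (rule that[of "inv_into {..<CARD('a)} e" e])
    show "inv_into {..<CARD('a)} e a < CARD('a)" for a
      using bij_betw_apply[OF bij_betw_inv_into[OF e], of a] by simp
  qed (simp_all add: bij_betw_inv_into_left[OF e] bij_betw_inv_into_right[OF e])
qed

text \<open>By Kronecker's theorem the integer multiples of a single column of \<beta> approximate
  every vector modulo integer vectors.\<close>

lemma holonomy_group_dense:
  fixes \<beta> :: "real^'m^'n"
  assumes "nonquadratic_coeffs \<beta>"
  shows "closure (holonomy_group \<beta>) = UNIV"
proof -
  define n where "n = CARD('n)"
  define k :: 'm where "k = undefined"
  obtain e :: "nat \<Rightarrow> 'n" and e' where e': "\<And>j. e' j < n" "\<And>j. e (e' j) = j"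
      and e'e: "\<And>i. i < n \<Longrightarrow> e' (e i) = i"
    by (rule finite_type_enumeration[where 'a = 'n, folded n_def]) (rule that)
  \<comment> \<open>The value 1 at index \<open>n\<close> stands for the integer translations in the
    independence condition.\<close>
  define \<theta> where "\<theta> i = (if i < n then \<beta> $ e i $ k else 1)" for i
  have rel: "c i = 0" if "(\<Sum>i\<le>n. of_int (c i) * \<theta> i) = 0" "i \<le> n" for c :: "nat \<Rightarrow> int" and i
  proof -
    have "(\<Sum>i\<le>n. of_int (c i) * \<theta> i) = (\<Sum>i<n. of_int (c i) * \<theta> i) + of_int (c n)"
      by (simp add: \<theta>_def flip: lessThan_Suc_atMost)
    also have "(\<Sum>i<n. of_int (c i) * \<theta> i) = (\<Sum>j\<in>UNIV. of_int (c (e' j)) * \<beta> $ j $ k)"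
      by (rule sum.reindex_bij_witness[of _ e' e]) (use e' e'e in \<open>auto simp: \<theta>_def\<close>)
    finally have 0: "(\<Sum>j\<in>UNIV. of_int (c (e' j)) * \<beta> $ j $ k) + of_int (c n) = 0"
      using that(1) by simp
    show ?thesis
    proof (cases "i = n")
      case True
      then show ?thesis using nonquadratic_affine_relation(2)[OF assms 0] by simp
    next
      case False
      then show ?thesis
        using nonquadratic_affine_relation(1)[OF assms 0, of "e i"] e'e[of i] that(2) by simp
    qed
  qed
  have inj: "inj_on \<theta> {..n}"
  proof (rule inj_onI, rule ccontr)
    fix i j assume ij: "i \<in> {..n}" "j \<in> {..n}" "\<theta> i = \<theta> j" "i \<noteq> j"
    \<comment> \<open>A coincidence of two values would be a relation with coefficients 1 and
      -1.\<close>
    define c :: "nat \<Rightarrow> int" where "c l = (if l = i then 1 else 0) - (if l = j then 1 else 0)" for l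
    have "(\<Sum>l\<le>n. of_int (c l) * \<theta> l) = 0"
      using ij by (simp add: c_def left_diff_distrib sum_subtractf if_distrib[where f=of_int]
          if_distrib[where f="\<lambda>x. x * _"] cong: if_cong)
    from rel[OF this, of i] show False
      using ij by (simp add: c_def)
  qed
  interpret module "\<lambda>r. (*) (real_of_int r)"
    by (simp add: Modules.module.intro distrib_left mult.commute)
  have indep: "independent (\<theta> ` {..n})"
    unfolding independent_explicit_module
  proof (intro allI impI)
    fix t u v assume t: "finite t" "t \<subseteq> \<theta> ` {..n}" "(\<Sum>v\<in>t. real_of_int (u v) * v) = 0" "v \<in> t"
    define c where "c i = (if \<theta> i \<in> t then u (\<theta> i) else 0)" for i
    have "(\<Sum>i\<le>n. of_int (c i) * \<theta> i) = (\<Sum>x\<in>\<theta> ` {..n}. of_int (if x \<in> t then u x else 0) * x)"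
      using inj by (simp add: sum.reindex c_def)
    also have "\<dots> = (\<Sum>x\<in>t. of_int (u x) * x)"
      by (rule sum.mono_neutral_cong_right) (use t in auto)
    finally have 0: "(\<Sum>i\<le>n. of_int (c i) * \<theta> i) = 0"
      using t by simp
    obtain i where "i \<le> n" "v = \<theta> i" using t by blast
    then show "u v = 0"
      using rel[OF 0, of i] t by (simp add: c_def)
  qed
  have "\<exists>\<gamma>\<in>holonomy_group \<beta>. dist \<gamma> v < \<epsilon>" if "\<epsilon> > 0" for v :: "real^'n" and \<epsilon>
  proof -
    \<comment> \<open>The norm is at most the sum of the \<open>n\<close> absolute coordinates, so
      each coordinate may deviate by less than \<open>\<epsilon> / n\<close>.\<close>
    have "\<epsilon> / n > 0"
      using that by (simp add: n_def)
    then obtain q p where qp: "\<And>i. i < n \<Longrightarrow> \<bar>of_int q * \<theta> i - of_int (p i) - v $ e i\<bar> < \<epsilon> / n"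
      using Kronecker_thm_2[OF indep inj, of "\<epsilon> / n" "\<lambda>i. v $ e i"] by (auto simp: \<theta>_def)
    define \<gamma> :: "real^'n" where "\<gamma> = (\<chi> j. of_int q * \<beta> $ j $ k - of_int (p (e' j)))"
    have "\<gamma> \<in> holonomy_group \<beta>"
      unfolding holonomy_group_mem_iff
      by (intro exI[of _ "\<lambda>i. if i = k then q else 0"] exI[of _ "\<lambda>j. - p (e' j)"])
        (simp add: \<gamma>_def if_distrib[where f=of_int] if_distrib[where f="\<lambda>x. _ * x"] cong: if_cong)
    moreover have "\<bar>(\<gamma> - v) $ j\<bar> < \<epsilon> / n" for j
      using qp[of "e' j"] e'[of j] by (simp add: \<gamma>_def \<theta>_def)
    then have "(\<Sum>j\<in>UNIV. \<bar>(\<gamma> - v) $ j\<bar>) < (\<Sum>j\<in>(UNIV :: 'n set). \<epsilon> / n)"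
      by (intro sum_strict_mono) auto
    then have "(\<Sum>j\<in>UNIV. \<bar>(\<gamma> - v) $ j\<bar>) < \<epsilon>"
      by (simp add: n_def)
    then have "dist \<gamma> v < \<epsilon>"
      unfolding dist_norm using norm_le_l1_cart[of "\<gamma> - v"] by linarith
    ultimately show ?thesis by blast
  qed
  then show ?thesis
    by (auto simp: closure_approachable)
qed

section \<open>Local equivariant maps are affine\<close>

text \<open>The image is connected, and a connected subset of a metric space with two distinct
  points is uncountable.\<close>

lemma continuous_countable_range_constant:
  fixes f :: "'a::topological_space \<Rightarrow> 'b::metric_space"
  assumes "connected S" "continuous_on S f" "countable (f ` S)" "x \<in> S" "y \<in> S"
  shows "f x = f y"
  using connected_uncountable[OF connected_continuous_image[OF assms(2,1)], of "f x" "f y"] assms(3-5)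
  by blast

text \<open>Additivity gives homogeneity for rational scalars; the scalars that satisfy it form a
  closed set, and the rationals are dense.\<close>

lemma continuous_additive_imp_linear:
  fixes K :: "'a::real_normed_vector \<Rightarrow> 'b::real_normed_vector"
  assumes add: "\<And>u v. K (u + v) = K u + K v" and cont: "continuous_on UNIV K"
  shows "linear K"
proof (rule linearI[OF add])
  interpret additive K by unfold_locales (rule add)
  fix c v
  have nat: "K (of_nat k *\<^sub>R w) = of_nat k *\<^sub>R K w" for k w
    by (induction k) (simp_all add: add zero scaleR_add_left)
  have int: "K (of_int k *\<^sub>R w) = of_int k *\<^sub>R K w" for k w
    using nat by (cases k rule: int_cases2) (simp_all add: minus)
  have rat: "K (q *\<^sub>R v) = q *\<^sub>R K v" if "q \<in> \<rat>" for q
  proof -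
    obtain a b :: int where b: "b > 0" and q: "q = of_int a / of_int b"
      using \<open>q \<in> \<rat>\<close> by (metis Rats_cases')
    have "of_int b *\<^sub>R K (q *\<^sub>R v) = of_int a *\<^sub>R K v"
      using b by (simp add: q flip: int)
    also have "\<dots> = of_int b *\<^sub>R (q *\<^sub>R K v)"
      using b by (simp add: q)
    finally show ?thesis
      by (rule scaleR_left_imp_eq[rotated]) (use b in simp)
  qed
  have "continuous_on UNIV (\<lambda>c. K (c *\<^sub>R v) - c *\<^sub>R K v)"
    by (intro continuous_intros continuous_on_compose2[OF cont]) auto
  then have "closed {c. K (c *\<^sub>R v) - c *\<^sub>R K v = 0}"
    by (intro closed_Collect_eq) auto
  moreover have "\<rat> \<subseteq> {c. K (c *\<^sub>R v) - c *\<^sub>R K v = 0}"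
    using rat by auto
  ultimately have "closure \<rat> \<subseteq> {c. K (c *\<^sub>R v) - c *\<^sub>R K v = 0}"
    by (rule closure_minimal[rotated])
  then show "K (c *\<^sub>R v) = c *\<^sub>R K v"
    by (auto simp: Rats_closure_real)
qed

text \<open>A vector is divided by an integer until it lies in the ball, \<open>k\<close> is
  applied, and the result is multiplied back. Additivity in the ball makes the outcome independent
  of the integer.\<close>

lemma local_additive_extends_linear:
  fixes k :: "'a::real_normed_vector \<Rightarrow> 'b::real_normed_vector"
  assumes "r > 0" and cont: "continuous_on (ball 0 r) k"
    and add: "\<And>u v. \<lbrakk>norm u < r; norm v < r; norm (u + v) < r\<rbrakk> \<Longrightarrow> k (u + v) = k u + k v"
  obtains A where "linear A" "\<And>v. norm v < r \<Longrightarrow> A v = k v"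
proof -
  have k0: "k 0 = 0"
    using add[of 0 0] \<open>r > 0\<close> by simp
  have mult: "k (of_nat p *\<^sub>R w) = of_nat p *\<^sub>R k w" if "norm (of_nat p *\<^sub>R w) < r" for p w
    using that
  proof (induction p)
    case (Suc p)
    have "norm (of_nat p *\<^sub>R w) \<le> norm (of_nat (Suc p) *\<^sub>R w)" "norm w \<le> norm (of_nat (Suc p) *\<^sub>R w)"
      by (simp_all add: mult_right_mono mult_le_cancel_right1)
    with Suc.prems have "norm (of_nat p *\<^sub>R w) < r" "norm w < r"
      by linarith+
    then show ?case
      using add[of w "of_nat p *\<^sub>R w"] Suc by (simp add: scaleR_add_left)
  qed (simp add: k0)
  \<comment> \<open>The successor makes \<open>N v\<close> positive and puts
    \<open>v /\<^sub>R of_nat (N v)\<close> strictly inside the ball.\<close>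
  define N where "N v = Suc (nat \<lceil>norm v / r\<rceil>)" for v :: 'a
  define K where "K v = of_nat (N v) *\<^sub>R k (v /\<^sub>R of_nat (N v))" for v
  have N: "norm v < of_nat (N v) * r" for v
  proof -
    have "norm v / r < of_nat (N v)"
      unfolding N_def by linarith
    then show ?thesis
      using \<open>r > 0\<close> by (simp add: field_simps)
  qed
  have K: "K v = of_nat p *\<^sub>R k (v /\<^sub>R of_nat p)" if "norm v < of_nat p * r" for v p
  proof -
    have p: "p > 0" using that by (cases "p = 0") auto
    have q: "N v > 0" by (simp add: N_def)
    \<comment> \<open>Common refinement: both scaled copies of \<open>v\<close> are integer
      multiples of \<open>?w\<close>.\<close>
    let ?w = "v /\<^sub>R (of_nat p * of_nat (N v))"
    have 1: "of_nat p *\<^sub>R ?w = v /\<^sub>R of_nat (N v)" "of_nat (N v) *\<^sub>R ?w = v /\<^sub>R of_nat p"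
      using p q by simp_all
    have "k (v /\<^sub>R of_nat (N v)) = of_nat p *\<^sub>R k ?w"
      using mult[of p ?w] N[of v] p q unfolding 1 by (simp add: field_simps)
    moreover have "k (v /\<^sub>R of_nat p) = of_nat (N v) *\<^sub>R k ?w"
      using mult[of "N v" ?w] that p q unfolding 1 by (simp add: field_simps)
    ultimately show ?thesis
      unfolding K_def by (simp add: mult.commute)
  qed
  have small: "norm (w /\<^sub>R of_nat p) < r" if "norm w < of_nat p * r" "p > 0" for w :: 'a and p :: nat
    using that by (simp add: field_simps)
  have "linear K"
  proof (rule continuous_additive_imp_linear)
    fix u v
    \<comment> \<open>One divisor large enough for \<open>u\<close>, \<open>v\<close> and
      \<open>u + v\<close> at once.\<close>
    define p where "p = N u + N v"
    have u: "norm u < of_nat p * r" and v: "norm v < of_nat p * r" and uv: "norm (u + v) < of_nat p * r"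
      using N[of u] N[of v] norm_triangle_ineq[of u v] norm_ge_zero[of u] norm_ge_zero[of v]
      unfolding p_def of_nat_add distrib_right by linarith+
    have p: "p > 0" by (simp add: p_def N_def)
    have "k (u /\<^sub>R of_nat p + v /\<^sub>R of_nat p) = k (u /\<^sub>R of_nat p) + k (v /\<^sub>R of_nat p)"
      using small[OF u p] small[OF v p] small[OF uv p] by (intro add) (simp_all only: scaleR_add_right)
    then show "K (u + v) = K u + K v"
      unfolding K[OF u] K[OF v] K[OF uv] by (simp add: scaleR_add_right)
  next
    have "isCont K v" for v
    proof -
      \<comment> \<open>Near \<open>v\<close> the divisor can be kept fixed, and for a fixed divisor
        the formula is visibly continuous.\<close>
      define p where "p = N v"
      have p: "p > 0" by (simp add: p_def N_def)
      have S: "open (ball (0::'a) (of_nat p * r))" "v \<in> ball 0 (of_nat p * r)"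
        using N[of v] by (simp_all add: p_def)
      have "continuous_on (ball 0 (of_nat p * r)) (\<lambda>v. of_nat p *\<^sub>R k (v /\<^sub>R of_nat p))"
        by (intro continuous_intros continuous_on_compose2[OF cont])
           (use small p in auto)
      then have "continuous_on (ball 0 (of_nat p * r)) K"
        by (rule continuous_on_eq) (simp add: K)
      then show ?thesis
        using S continuous_on_eq_continuous_at by blast
    qed
    then show "continuous_on UNIV K"
      by (simp add: continuous_at_imp_continuous_on)
  qed
  moreover have "K v = k v" if "norm v < r" for v
    using K[of v 1] that by simp
  ultimately show ?thesis using that by blast
qed

text \<open>For \<gamma> in \<Gamma> the increment h(x + \<gamma>) - h(x) is continuous with values
  in the countable set \<Delta>, hence constant in x. Density of \<Gamma> turns this into additivity
  of h - h(0) near 0.\<close>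

lemma subgroup_equivariant_lift_affine:
  fixes h :: "'a::euclidean_space \<Rightarrow> 'b::euclidean_space"
  assumes \<Gamma>: "subgroup \<Gamma> additive_group" and dense: "closure \<Gamma> = UNIV"
    and \<Delta>: "countable \<Delta>" "subgroup \<Delta> additive_group"
    and "r > 0" and cont: "continuous_on (ball 0 r) h"
    and equiv: "\<And>x y. \<lbrakk>norm x < r; norm y < r; x - y \<in> \<Gamma>\<rbrakk> \<Longrightarrow> h x - h y \<in> \<Delta>"
  obtains A where "linear A" "\<And>v. norm v < r \<Longrightarrow> h v = h 0 + A v" "A ` \<Gamma> \<subseteq> \<Delta>"
proof -
  have step: "h (v + \<gamma>) - h v = h \<gamma> - h 0"
    if "\<gamma> \<in> \<Gamma>" "norm \<gamma> < r" "norm v < r" "norm (v + \<gamma>) < r" for v \<gamma>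
  proof -
    \<comment> \<open>The points \<open>x\<close> for which \<open>x\<close> and
      \<open>x + \<gamma>\<close> both lie in the ball form a convex, hence connected, set. It
      contains 0, where the increment is compared.\<close>
    let ?S = "ball 0 r \<inter> ball (- \<gamma>) r"
    have S: "norm x < r \<and> norm (x + \<gamma>) < r \<longleftrightarrow> x \<in> ?S" for x
    proof -
      have "dist (- \<gamma>) x = norm (x + \<gamma>)"
        by (subst dist_commute) (simp add: dist_norm)
      then show ?thesis by simp
    qed
    have "h (v + \<gamma>) - h v = h (0 + \<gamma>) - h 0"
    proof (rule continuous_countable_range_constant[where f = "\<lambda>x. h (x + \<gamma>) - h x" and S = ?S])
      show "connected ?S"
        by (intro convex_connected convex_Int convex_ball)
      show "continuous_on ?S (\<lambda>x. h (x + \<gamma>) - h x)"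
        by (intro continuous_intros continuous_on_compose2[OF cont])
          (use S[THEN iffD2] in \<open>simp_all add: image_subset_iff\<close>)
      have "(\<lambda>x. h (x + \<gamma>) - h x) ` ?S \<subseteq> \<Delta>"
      proof (rule image_subsetI)
        fix x assume "x \<in> ?S"
        then have "norm x < r" "norm (x + \<gamma>) < r"
          using S[of x] by blast+
        then show "h (x + \<gamma>) - h x \<in> \<Delta>"
          using equiv[of "x + \<gamma>" x] that(1) by simp
      qed
      then show "countable ((\<lambda>x. h (x + \<gamma>) - h x) ` ?S)"
        using \<Delta>(1) countable_subset by blast
    qed (use S[of v] S[of 0] that \<open>r > 0\<close> in auto)
    then show ?thesis by simp
  qed
  have add: "h (v + w) - h 0 = (h v - h 0) + (h w - h 0)"
    if "norm v < r" "norm w < r" "norm (v + w) < r" for v w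
  proof -
    \<comment> \<open>Elements of \<Gamma> approximate \<open>w\<close>; continuity at
      \<open>w\<close> and at \<open>v + w\<close> carries their increment formula to the
      limit.\<close>
    obtain g where g: "\<And>i. g i \<in> \<Gamma>" "g \<longlonglongrightarrow> w"
      using dense closure_sequential[of w \<Gamma>] by auto
    have vg: "(\<lambda>i. v + g i) \<longlonglongrightarrow> v + w"
      by (intro tendsto_intros g)
    have isC: "isCont h x" if "norm x < r" for x
      using cont that by (simp add: continuous_on_eq_continuous_at)
    have lim1: "(\<lambda>i. h (v + g i) - h v) \<longlonglongrightarrow> h (v + w) - h v"
      by (intro tendsto_intros isCont_tendsto_compose[OF isC vg] that)
    have lim2: "(\<lambda>i. h (g i) - h 0) \<longlonglongrightarrow> h w - h 0"
      by (intro tendsto_intros isCont_tendsto_compose[OF isC g(2)] that)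
    have ev: "\<forall>\<^sub>F i in sequentially. h (v + g i) - h v = h (g i) - h 0"
      using order_tendstoD(2)[OF tendsto_norm[OF g(2)] that(2)]
        order_tendstoD(2)[OF tendsto_norm[OF vg] that(3)]
      by eventually_elim (use step g(1) that(1) in blast)
    have "h (v + w) - h v = h w - h 0"
      by (rule LIMSEQ_unique[OF lim1]) (rule tendsto_cong[OF ev, THEN iffD2, OF lim2])
    then show ?thesis by (simp add: algebra_simps)
  qed
  obtain A where A: "linear A" "\<And>v. norm v < r \<Longrightarrow> A v = h v - h 0"
    by (rule local_additive_extends_linear[OF \<open>r > 0\<close>, of "\<lambda>v. h v - h 0"])
      (use add in \<open>auto intro!: continuous_intros cont\<close>)
  interpret A: linear A by fact
  define H where "H = {\<gamma> \<in> \<Gamma>. A \<gamma> \<in> \<Delta>}"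
  have H: "subgroup H additive_group"
    using \<Gamma> \<Delta>(2) by (auto simp: H_def additive_subgroup_iff A.add A.neg)
  have small: "\<gamma> \<in> H" if "\<gamma> \<in> \<Gamma>" "norm \<gamma> < r" for \<gamma>
    using A(2)[OF that(2)] equiv[of \<gamma> 0] that \<open>r > 0\<close> by (simp add: H_def)
  \<comment> \<open>\<open>H\<close> contains the small elements of the dense group \<open>\<Gamma>\<close>, so its \<open>r / 2\<close>-neighbourhood is
    open and closed, hence everything, and \<open>H = \<Gamma>\<close>.\<close>
  let ?U = "\<Union>\<eta>\<in>H. ball \<eta> (r / 2)"
  have "\<exists>\<eta>\<in>H. dist \<eta> x < r / 2" if x: "x \<in> closure ?U" for x
  proof -
    \<comment> \<open>The distances r/4, r/4 and r/2 add up to r, so that \<open>small\<close>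
      applies to \<open>\<gamma> - \<eta>\<close>.\<close>
    obtain y where y: "y \<in> ?U" "dist y x < r / 4"
      using x \<open>r > 0\<close> unfolding closure_approachable by (meson divide_pos_pos zero_less_numeral)
    then obtain \<eta> where \<eta>: "\<eta> \<in> H" "dist \<eta> y < r / 2" by auto
    have "x \<in> closure \<Gamma>" using dense by simp
    then obtain \<gamma> where \<gamma>: "\<gamma> \<in> \<Gamma>" "dist \<gamma> x < r / 4"
      using \<open>r > 0\<close> unfolding closure_approachable by (meson divide_pos_pos zero_less_numeral)
    have "dist \<gamma> \<eta> \<le> dist \<gamma> x + dist x y + dist y \<eta>"
      using dist_triangle[of \<gamma> \<eta> x] dist_triangle[of x \<eta> y] by linarith
    then have "norm (\<gamma> - \<eta>) < r"
      using y(2) \<eta>(2) \<gamma>(2) dist_commute[of x y] dist_commute[of y \<eta>]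
      unfolding dist_norm[of \<gamma> \<eta>] by linarith
    moreover have "\<gamma> - \<eta> \<in> \<Gamma>"
      using additive_subgroup_diff[OF \<Gamma>] \<gamma> \<eta> by (simp add: H_def)
    ultimately have "\<gamma> - \<eta> \<in> H" by (rule small[rotated])
    then have "\<gamma> \<in> H"
      using additive_subgroup_diff_cancel[OF H] \<eta>(1) by blast
    then show ?thesis using \<gamma>(2) \<open>r > 0\<close> by (intro bexI[of _ \<gamma>]) auto
  qed
  then have "closure ?U \<subseteq> ?U"
    by auto
  then have "closed ?U"
    by (simp only: closure_subset_eq)
  moreover have "open ?U" by blast
  moreover have "0 \<in> ?U"
    using H \<open>r > 0\<close> by (auto simp: additive_subgroup_iff intro!: bexI[of _ 0])
  ultimately have U: "?U = UNIV"
    using clopen[of ?U] by blast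
  have "A \<gamma> \<in> \<Delta>" if "\<gamma> \<in> \<Gamma>" for \<gamma>
  proof -
    obtain \<eta> where \<eta>: "\<eta> \<in> H" "dist \<eta> \<gamma> < r / 2"
    proof -
      have "\<gamma> \<in> ?U" by (simp only: U UNIV_I)
      then show ?thesis using that by auto
    qed
    then have "\<gamma> - \<eta> \<in> H"
      using \<open>r > 0\<close> that additive_subgroup_diff[OF \<Gamma>]
      by (intro small) (simp_all add: H_def dist_norm norm_minus_commute)
    then have "\<gamma> \<in> H"
      using additive_subgroup_diff_cancel[OF H] \<eta>(1) by blast
    then show ?thesis by (simp add: H_def)
  qed
  then have "A ` \<Gamma> \<subseteq> \<Delta>" by blast
  moreover have "h v = h 0 + A v" if "norm v < r" for v
    using A(2)[OF that] by simp
  ultimately show ?thesis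
    using that[OF A(1)] by blast
qed

section \<open>Quotients of the standard diffeology\<close>

text \<open>Partial derivatives commute with \<open>L\<close> and kill the constant; the induction
  is general in \<open>c\<close> so that it can be applied to them with
  \<open>c = 0\<close>.\<close>

lemma Ck_on_affine:
  assumes "bounded_linear L" "Ck_on k p U f"
  shows "Ck_on k p U (\<lambda>x. L (f x) + c)"
  using assms(2)
proof (induction k arbitrary: f c)
  case 0
  then show ?case unfolding Ck_on.simps
    by (intro continuous_on_add continuous_on_const bounded_linear.continuous_on[OF assms(1)]) simp
next
  case (Suc k)
  from Suc.prems obtain g where "\<forall>i<p. (\<forall>x\<in>U. ((\<lambda>t. f (x(i := t))) has_vector_derivative g i x) (at (x i)))
      \<and> Ck_on k p U (g i)"
    unfolding Ck_on.simps by blast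
  then have g: "\<And>i x. \<lbrakk>i < p; x \<in> U\<rbrakk> \<Longrightarrow> ((\<lambda>t. f (x(i := t))) has_vector_derivative g i x) (at (x i))"
    "\<And>i. i < p \<Longrightarrow> Ck_on k p U (g i)"
    by blast+
  have "((\<lambda>t. L (f (x(i := t))) + c) has_vector_derivative L (g i x)) (at (x i))"
    if "i < p" "x \<in> U" for i x
    using bounded_linear.has_vector_derivative[OF assms(1) g(1)[OF that]]
    by (simp add: has_vector_derivative_add_const)
  moreover have "Ck_on k p U (\<lambda>x. L (g i x))" if "i < p" for i
    using Suc.IH[OF g(2)[OF that], of 0] by simp
  moreover have "continuous_on U (\<lambda>x. L (f x) + c)"
    using Suc.prems
    by (intro continuous_on_add continuous_on_const bounded_linear.continuous_on[OF assms(1)]) simp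
  ultimately show ?case
    by (auto intro!: exI[of _ "\<lambda>i x. L (g i x)"])
qed

lemma Ck_on_const: "Ck_on k p U (\<lambda>_. c)"
proof (induction k arbitrary: c)
  case (Suc k)
  then show ?case by (auto intro!: exI[of _ "\<lambda>_ _. 0"])
qed simp

lemma Ck_on_coordinates: "Ck_on k p U (\<lambda>x. \<chi> j. x (\<iota> j))"
  for \<iota> :: "'n::finite \<Rightarrow> nat"
proof -
  have "continuous_on U (\<lambda>x :: nat \<Rightarrow> real. x i)" for i
    by (rule continuous_on_product_then_coordinatewise) (rule continuous_on_id)
  then have cont: "continuous_on U (\<lambda>x. \<chi> j. x (\<iota> j))"
    by (intro continuous_on_vec_lambda)
  show ?thesis
  proof (cases k)
    case 0
    then show ?thesis using cont by simp
  next
    case (Suc k')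
    \<comment> \<open>Along the i-th axis the map is affine with slope \<open>b i\<close>, so its
      partial derivatives are constant.\<close>
    define b :: "nat \<Rightarrow> real^'n" where "b i = (\<chi> j. if \<iota> j = i then 1 else 0)" for i
    have eq: "(\<lambda>t. \<chi> j. (x(i := t)) (\<iota> j)) = (\<lambda>t. (\<chi> j. if \<iota> j = i then 0 else x (\<iota> j)) + t *\<^sub>R b i)"
      for x :: "nat \<Rightarrow> real" and i
      by (simp add: fun_eq_iff vec_eq_iff b_def)
    have "((\<lambda>t. \<chi> j. (x(i := t)) (\<iota> j)) has_vector_derivative b i) (at (x i))" for x i
      unfolding eq by (auto intro!: derivative_eq_intros)
    then show ?thesis
      unfolding Suc Ck_on.simps using cont
      by (intro conjI exI[of _ "\<lambda>i _. b i"] allI impI ballI Ck_on_const) auto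
  qed
qed

lemma std_diffeology_affine:
  fixes L :: "'a::euclidean_space \<Rightarrow> 'b::real_normed_vector"
  assumes "linear L" "std_diffeology p U f"
  shows "std_diffeology p U (\<lambda>x. L (f x) + c)"
  using assms by (simp add: std_diffeology_def Ck_on_affine linear_conv_bounded_linear)

section \<open>Quotient diffeologies and maps covered by affine maps\<close>

text \<open>A local lift is lifted once more on a smaller neighbourhood. This presents the leaf
  space directly as a quotient of a vector space, without passing through the torus.\<close>

lemma quotient_quotient_diffeology:
  "quotient_diffeology (quotient_diffeology D \<pi>) \<rho> = quotient_diffeology D (\<lambda>x. \<rho> (\<pi> x))"
proof (intro ext iffI)
  fix p U f
  assume f: "quotient_diffeology (quotient_diffeology D \<pi>) \<rho> p U f"
  show "quotient_diffeology D (\<lambda>x. \<rho> (\<pi> x)) p U f"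
    unfolding quotient_diffeology_def
  proof (intro conjI ballI)
    show "openin (Euclidean_space p) U"
      using f by (simp add: quotient_diffeology_def)
    fix x assume "x \<in> U"
    then obtain W g where W: "W \<subseteq> U" "x \<in> W" "quotient_diffeology D \<pi> p W g" "\<forall>w\<in>W. f w = \<rho> (g w)"
      using f unfolding quotient_diffeology_def[of _ \<rho>] by blast
    then obtain W' g' where "openin (Euclidean_space p) W'" "x \<in> W'" "W' \<subseteq> W" "D p W' g'" "\<forall>w\<in>W'. g w = \<pi> (g' w)"
      unfolding quotient_diffeology_def[of _ \<pi>] by blast
    with W show "\<exists>W g. openin (Euclidean_space p) W \<and> x \<in> W \<and> W \<subseteq> U \<and> D p W g \<and> (\<forall>w\<in>W. f w = \<rho> (\<pi> (g w)))"
      by (intro exI[of _ W'] exI[of _ g']) auto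
  qed
next
  fix p U f
  assume f: "quotient_diffeology D (\<lambda>x. \<rho> (\<pi> x)) p U f"
  show "quotient_diffeology (quotient_diffeology D \<pi>) \<rho> p U f"
    unfolding quotient_diffeology_def[of _ \<rho>]
  proof (intro conjI ballI)
    show "openin (Euclidean_space p) U"
      using f by (simp add: quotient_diffeology_def)
    fix x assume "x \<in> U"
    then obtain W g where W: "openin (Euclidean_space p) W" "W \<subseteq> U" "x \<in> W" "D p W g" "\<forall>w\<in>W. f w = \<rho> (\<pi> (g w))"
      using f unfolding quotient_diffeology_def by blast
    then have "quotient_diffeology D \<pi> p W (\<lambda>w. \<pi> (g w))"
      unfolding quotient_diffeology_def by blast
    with W show "\<exists>W g. openin (Euclidean_space p) W \<and> x \<in> W \<and> W \<subseteq> U \<and> quotient_diffeology D \<pi> p W g \<and> (\<forall>w\<in>W. f w = \<rho> (g w))"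
      by (intro exI[of _ W] exI[of _ "\<lambda>w. \<pi> (g w)"]) auto
  qed
qed

abbreviation quotient_of_std :: "('b::real_normed_vector \<Rightarrow> 'x) \<Rightarrow> 'x diffeology" where
  "quotient_of_std \<equiv> quotient_diffeology std_diffeology"

text \<open>If \<open>g\<close> lifts \<open>f\<close> locally, then the smooth map
  \<open>\<lambda>w. L (g w) + c\<close> lifts \<open>F \<circ> f\<close>.\<close>

lemma quotient_of_std_affine:
  fixes \<pi> :: "'a::euclidean_space \<Rightarrow> 'x" and \<rho> :: "'b::real_normed_vector \<Rightarrow> 'y"
  assumes "linear L" and F: "\<And>z. F (\<pi> z) = \<rho> (L z + c)"
    and f: "quotient_of_std \<pi> p U f"
  shows "quotient_of_std \<rho> p U (F \<circ> f)"
  unfolding quotient_diffeology_def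
proof (intro conjI ballI)
  show "openin (Euclidean_space p) U"
    using f by (simp add: quotient_diffeology_def)
  fix x assume "x \<in> U"
  then obtain W g where W: "openin (Euclidean_space p) W" "W \<subseteq> U" "x \<in> W"
      "std_diffeology p W g" "\<forall>w\<in>W. f w = \<pi> (g w)"
    using f unfolding quotient_diffeology_def by blast
  moreover have "std_diffeology p W (\<lambda>w. L (g w) + c)"
    by (rule std_diffeology_affine) fact+
  ultimately show "\<exists>W g. openin (Euclidean_space p) W \<and> x \<in> W \<and> W \<subseteq> U \<and> std_diffeology p W g \<and> (\<forall>w\<in>W. (F \<circ> f) w = \<rho> (g w))"
    using F by (intro exI[of _ W] exI[of _ "\<lambda>w. L (g w) + c"]) auto
qed

lemma differentiable_map_affine:
  fixes \<pi> :: "'a::euclidean_space \<Rightarrow> 'x" and \<rho> :: "'b::real_normed_vector \<Rightarrow> 'y"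
  assumes "linear L" and "\<And>z. F (\<pi> z) = \<rho> (L z + c)"
  shows "differentiable_map (range \<pi>) (quotient_of_std \<pi>) (range \<rho>) (quotient_of_std \<rho>) F"
  unfolding differentiable_map_def
  using quotient_of_std_affine[where F = F and \<pi> = \<pi> and \<rho> = \<rho> and L = L and c = c, OF assms] assms(2)
  by auto

text \<open>On the range of \<open>\<rho>\<close> the inverse of \<open>F\<close> agrees with
  \<open>G\<close>, so it is covered by an affine map too.\<close>

lemma diffeomorphism_affine:
  fixes \<pi> :: "'a::euclidean_space \<Rightarrow> 'x" and \<rho> :: "'b::euclidean_space \<Rightarrow> 'y"
  assumes L: "linear L" "\<And>z. F (\<pi> z) = \<rho> (L z + c)"
    and M: "linear M" "\<And>y. G (\<rho> y) = \<pi> (M y + d)"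
    and GF: "\<And>z. G (F (\<pi> z)) = \<pi> z" and FG: "\<And>y. F (G (\<rho> y)) = \<rho> y"
  shows "diffeomorphism (range \<pi>) (quotient_of_std \<pi>) (range \<rho>) (quotient_of_std \<rho>) F"
proof -
  have F: "differentiable_map (range \<pi>) (quotient_of_std \<pi>) (range \<rho>) (quotient_of_std \<rho>) F"
    by (rule differentiable_map_affine) fact+
  have bij: "bij_betw F (range \<pi>) (range \<rho>)"
    by (rule bij_betw_byWitness[of _ G]) (use GF FG L(2) M(2) in auto)
  have inv: "inv_into (range \<pi>) F (\<rho> y) = \<pi> (M y + d)" for y
    using bij FG[of y] M(2)[of y] by (intro inv_into_f_eq) (auto simp: bij_betw_def)
  have "differentiable_map (range \<rho>) (quotient_of_std \<rho>) (range \<pi>) (quotient_of_std \<pi>) (inv_into (range \<pi>) F)"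
    by (rule differentiable_map_affine[OF M(1)]) (rule inv)
  with F bij show ?thesis
    by (simp add: diffeomorphism_def)
qed

text \<open>Each projection factors through the other by a linear map, so the identity carries plots
  to plots in both directions.\<close>

lemma quotient_of_std_eqI:
  fixes \<pi> :: "'a::euclidean_space \<Rightarrow> 'x" and \<rho> :: "'b::euclidean_space \<Rightarrow> 'x"
  assumes "linear L" "linear M" and "\<And>z. \<pi> z = \<rho> (L z)" "\<And>y. \<rho> y = \<pi> (M y)"
  shows "quotient_of_std \<pi> = quotient_of_std \<rho>"
proof (intro ext iffI)
  fix p U f
  show "quotient_of_std \<rho> p U f" if "quotient_of_std \<pi> p U f"
    using quotient_of_std_affine[where F = id and \<pi> = \<pi> and \<rho> = \<rho> and c = 0, OF assms(1) _ that]
    by (simp add: assms(3))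
  show "quotient_of_std \<pi> p U f" if "quotient_of_std \<rho> p U f"
    using quotient_of_std_affine[where F = id and \<pi> = \<rho> and \<rho> = \<pi> and c = 0, OF assms(2) _ that]
    by (simp add: assms(4))
qed

section \<open>Lifting differentiable maps of the quotient\<close>

text \<open>The map \<open>f\<close> is tested on the projection \<open>\<pi>\<close> itself, viewed
  as a plot. The image plot has a smooth lift near the origin, of which only continuity is
  kept.\<close>

lemma differentiable_map_local_lift:
  fixes \<pi> :: "real^'n \<Rightarrow> 'x"
  assumes "differentiable_map (range \<pi>) (quotient_of_std \<pi>) (range \<pi>) (quotient_of_std \<pi>) f"
  obtains r h where "r > 0" "continuous_on (ball 0 r) h" "\<And>y. norm y < r \<Longrightarrow> f (\<pi> y) = \<pi> (h y)"
proof -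
  define n where "n = CARD('n)"
  obtain e :: "nat \<Rightarrow> 'n" and \<iota> where \<iota>: "\<And>j. \<iota> j < n" "\<And>j. e (\<iota> j) = j"
    by (rule finite_type_enumeration[where 'a = 'n, folded n_def]) (rule that)
  define U where "U = topspace (Euclidean_space n)"
  \<comment> \<open>\<open>q\<close> reads the first \<open>n\<close> terms of a sequence as a
    vector, and \<open>s\<close> writes a vector as a point of
    \<open>Euclidean_space n\<close>.\<close>
  define q where "q = (\<lambda>x :: nat \<Rightarrow> real. \<chi> j. x (\<iota> j))"
  define s where "s y i = (if i < n then y $ e i else 0)" for y :: "real^'n" and i
  have qs: "q (s y) = y" for y
    by (simp add: q_def s_def \<iota> vec_eq_iff)
  have U: "openin (Euclidean_space n) U"
    by (simp add: U_def)
  have "quotient_of_std \<pi> n U (\<lambda>x. \<pi> (q x))"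
    unfolding quotient_diffeology_def std_diffeology_def
    using U by (auto intro!: exI[of _ U] exI[of _ q] simp: q_def Ck_on_coordinates)
  then have plot: "quotient_of_std \<pi> n U (f \<circ> (\<lambda>x. \<pi> (q x)))"
    by (rule assms[unfolded differentiable_map_def, THEN conjunct2, rule_format])
  have "s 0 \<in> U"
    by (simp add: U_def topspace_Euclidean_space s_def)
  with plot[unfolded quotient_diffeology_def, THEN conjunct2]
  obtain W g where W: "openin (Euclidean_space n) W" "s 0 \<in> W" "std_diffeology n W g"
      "\<forall>w\<in>W. (f \<circ> (\<lambda>x. \<pi> (q x))) w = \<pi> (g w)"
    by blast
  have g: "continuous_on W g"
    using W(3)[unfolded std_diffeology_def, THEN conjunct2, rule_format, of 0] by simp
  \<comment> \<open>\<open>W\<close> is the trace of an open set of sequences, whose preimage under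
    the continuous map \<open>s\<close> contains a ball around 0.\<close>
  obtain T where T: "open T" "W = T \<inter> {x. \<forall>i\<ge>n. x i = 0}"
    using W(1) by (auto simp: Euclidean_space_def openin_subtopology euclidean_product_topology)
  have s: "continuous_on UNIV s"
  proof (rule continuous_on_coordinatewise_then_product)
    show "continuous_on UNIV (\<lambda>y. s y i)" for i
      by (cases "i < n") (simp_all add: s_def continuous_on_component)
  qed
  have "open (s -` T)"
    using s T(1) by (simp add: continuous_on_open_vimage)
  moreover have "0 \<in> s -` T"
    using W(2) T(2) by simp
  ultimately obtain r where r: "r > 0" "ball 0 r \<subseteq> s -` T"
    by (rule openE)
  then have sW: "s y \<in> W" if "norm y < r" for y
    using that by (auto simp: T(2) s_def subset_iff)
  show ?thesis
  proof (rule that[OF r(1), of "\<lambda>y. g (s y)"])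
    show "continuous_on (ball 0 r) (\<lambda>y. g (s y))"
      by (rule continuous_on_compose2[OF g continuous_on_subset[OF s]]) (use sW in auto)
    show "f (\<pi> y) = \<pi> (g (s y))" if "norm y < r" for y
      using W(4)[rule_format, OF sW[OF that]] by (simp add: qs)
  qed
qed

text \<open>The local lift is affine near 0. By density every y differs from a point of the ball by
  some \<gamma> in \<Gamma>, and since A \<gamma> lies in \<Gamma> the formula extends to y.\<close>

lemma differentiable_map_affine_lift:
  fixes \<pi> :: "real^'n \<Rightarrow> 'x"
  assumes f: "differentiable_map (range \<pi>) (quotient_of_std \<pi>) (range \<pi>) (quotient_of_std \<pi>) f"
    and \<Gamma>: "subgroup \<Gamma> additive_group" "countable \<Gamma>" "closure \<Gamma> = UNIV"
    and \<pi>: "\<And>x y. \<pi> x = \<pi> y \<longleftrightarrow> x - y \<in> \<Gamma>"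
  obtains A c where "linear A" "A ` \<Gamma> \<subseteq> \<Gamma>" "\<And>y. f (\<pi> y) = \<pi> (A y + c)"
proof -
  obtain r h where r: "r > 0" "continuous_on (ball 0 r) h" "\<And>y. norm y < r \<Longrightarrow> f (\<pi> y) = \<pi> (h y)"
    by (rule differentiable_map_local_lift[OF f]) (rule that)
  have equiv: "h x - h y \<in> \<Gamma>" if "norm x < r" "norm y < r" "x - y \<in> \<Gamma>" for x y
  proof -
    have "\<pi> x = \<pi> y"
      using that(3) by (simp only: \<pi>)
    then have "\<pi> (h x) = \<pi> (h y)"
      using r(3)[OF that(1)] r(3)[OF that(2)] by simp
    then show ?thesis
      by (simp only: \<pi>)
  qed
  obtain A where A: "linear A" "\<And>v. norm v < r \<Longrightarrow> h v = h 0 + A v" "A ` \<Gamma> \<subseteq> \<Gamma>"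
    by (rule subgroup_equivariant_lift_affine[OF \<Gamma>(1,3,2,1) r(1,2) equiv]) (assumption+, rule that)
  interpret A: linear A by fact
  have "f (\<pi> y) = \<pi> (A y + h 0)" for y
  proof -
    have "y \<in> closure \<Gamma>" using \<Gamma>(3) by simp
    then obtain \<gamma> where \<gamma>: "\<gamma> \<in> \<Gamma>" "dist \<gamma> y < r"
      using r(1) unfolding closure_approachable by blast
    then have "norm (y - \<gamma>) < r"
      by (simp add: dist_norm norm_minus_commute)
    then have "f (\<pi> (y - \<gamma>)) = \<pi> (h 0 + A (y - \<gamma>))"
      using r(3) A(2) by simp
    moreover have "\<pi> y = \<pi> (y - \<gamma>)"
      using \<gamma> by (simp add: \<pi>)
    moreover have "\<pi> (A y + h 0) = \<pi> (h 0 + A (y - \<gamma>))"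
      using \<gamma> A(3) by (auto simp: \<pi> A.diff)
    ultimately show ?thesis by simp
  qed
  then show ?thesis
    using that A by blast
qed

section \<open>Diffeomorphisms of the leaf space\<close>

text \<open>Closure of \<open>G\<close> under multiplication is what allows \<open>h\<close> to be
  inverted at a product. For the semidirect product it can be checked directly, before any group
  axioms.\<close>

lemma iso_inverse_is_iso:
  assumes h: "h \<in> iso G H" and closed: "\<And>x y. \<lbrakk>x \<in> carrier G; y \<in> carrier G\<rbrakk> \<Longrightarrow> x \<otimes>\<^bsub>G\<^esub> y \<in> carrier G"
  shows "H \<cong> G"
proof (rule is_isoI)
  let ?g = "inv_into (carrier G) h"
  have hom: "h (x \<otimes>\<^bsub>G\<^esub> y) = h x \<otimes>\<^bsub>H\<^esub> h y" if "x \<in> carrier G" "y \<in> carrier G" for x y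
    using h that by (simp add: iso_def hom_def)
  have bij: "bij_betw h (carrier G) (carrier H)"
    using h by (simp add: iso_def)
  have g: "bij_betw ?g (carrier H) (carrier G)"
    by (rule bij_betw_inv_into[OF bij])
  have "?g (x \<otimes>\<^bsub>H\<^esub> y) = ?g x \<otimes>\<^bsub>G\<^esub> ?g y" if "x \<in> carrier H" "y \<in> carrier H" for x y
  proof -
    have xy: "?g x \<in> carrier G" "?g y \<in> carrier G"
      using g that by (auto simp: bij_betw_def)
    have "h (?g x \<otimes>\<^bsub>G\<^esub> ?g y) = x \<otimes>\<^bsub>H\<^esub> y"
      using hom[OF xy] bij that by (simp add: bij_betw_inv_into_right)
    then show ?thesis
      using bij closed[OF xy] by (metis bij_betw_inv_into_left)
  qed
  then show "?g \<in> iso H G"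
    using g by (auto simp: iso_def hom_def bij_betw_def)
qed

section \<open>Affine maps of a quotient by \<Gamma>\<close>

text \<open>Only the fibres of the projection are prescribed, so its range may be the leaf space
  itself instead of the set of cosets.\<close>

locale holonomy_projection =
  fixes \<beta> :: "real^'m^'n" and \<pi> :: "real^'n \<Rightarrow> 'x"
  assumes nonquadratic: "nonquadratic_coeffs \<beta>"
    and proj_eq_iff: "\<pi> x = \<pi> y \<longleftrightarrow> x - y \<in> holonomy_group \<beta>"
begin

text \<open>The restriction makes the map extensional, as elements of \<open>Bij\<close> must be.
  The chosen representative is immaterial when \<open>\<epsilon>\<close> is a sign, because signs
  preserve \<Gamma>.\<close>

definition affine_map :: "(real^'n \<Rightarrow> real^'n) \<Rightarrow> real^'n \<Rightarrow> 'x \<Rightarrow> 'x" where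
  "affine_map \<epsilon> c = (\<lambda>P\<in>range \<pi>. \<pi> (\<epsilon> (inv_into UNIV \<pi> P) + c))"

lemmas \<Gamma>_sub = subgroup_holonomy_group[of \<beta>, unfolded additive_subgroup_iff]

lemma affine_map_apply:
  assumes "\<epsilon> \<in> {id, uminus}"
  shows "affine_map \<epsilon> c (\<pi> y) = \<pi> (\<epsilon> y + c)"
proof -
  define z where "z = inv_into UNIV \<pi> (\<pi> y)"
  have "\<pi> z = \<pi> y"
    by (simp add: z_def f_inv_into_f)
  then have "z - y \<in> holonomy_group \<beta>"
    by (simp only: proj_eq_iff)
  moreover from this have "- (z - y) \<in> holonomy_group \<beta>"
    using \<Gamma>_sub by blast
  ultimately have "(\<epsilon> z + c) - (\<epsilon> y + c) \<in> holonomy_group \<beta>"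
    using assms by auto
  then have "\<pi> (\<epsilon> z + c) = \<pi> (\<epsilon> y + c)"
    by (simp only: proj_eq_iff)
  then show ?thesis
    by (simp add: affine_map_def z_def)
qed

lemma affine_map_cong: "c - d \<in> holonomy_group \<beta> \<Longrightarrow> affine_map \<epsilon> c = affine_map \<epsilon> d"
  unfolding affine_map_def by (intro restrict_ext) (simp add: proj_eq_iff)

lemma affine_map_compose:
  assumes "\<epsilon> \<in> {id, uminus}" "\<delta> \<in> {id, uminus}"
  shows "compose (range \<pi>) (affine_map \<epsilon> c) (affine_map \<delta> d) = affine_map (\<epsilon> \<circ> \<delta>) (c + \<epsilon> d)"
proof (rule extensionalityI[of _ "range \<pi>"])
  have ed: "\<epsilon> \<circ> \<delta> \<in> {id, uminus}" and add: "\<epsilon> (x + y) = \<epsilon> x + \<epsilon> y" for x y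
    using assms by (auto simp: fun_eq_iff)
  show "compose (range \<pi>) (affine_map \<epsilon> c) (affine_map \<delta> d) P = affine_map (\<epsilon> \<circ> \<delta>) (c + \<epsilon> d) P"
    if "P \<in> range \<pi>" for P
    using that assms affine_map_apply[OF ed]
    by (auto simp: compose_def affine_map_apply add algebra_simps)
qed (simp_all add: affine_map_def)

lemma affine_map_diffeomorphism:
  assumes "\<epsilon> \<in> {id, uminus}"
  shows "diffeomorphism (range \<pi>) (quotient_of_std \<pi>) (range \<pi>) (quotient_of_std \<pi>) (affine_map \<epsilon> c)"
\<comment> \<open>As \<open>\<epsilon>\<close> is an involution, the inverse affine map has sign
  \<open>\<epsilon>\<close> and translation part \<open>- \<epsilon> c\<close>.\<close>
proof (rule diffeomorphism_affine[where L = \<epsilon> and M = \<epsilon> and c = c and d = "- \<epsilon> c" and G = "affine_map \<epsilon> (- \<epsilon> c)"])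
  show "linear \<epsilon>"
    using assms by (auto simp: linear_id linear_uminus)
  then show "linear \<epsilon>" .
qed (use assms in \<open>auto simp: affine_map_apply\<close>)

text \<open>The value at 0 gives the translation part modulo \<Gamma>. If the signs differed, 2y
  would lie in \<Gamma> for every y, and the countable group \<Gamma> would be the whole
  space.\<close>

lemma affine_map_inj:
  assumes "\<epsilon> \<in> {id, uminus}" "\<delta> \<in> {id, uminus}" and eq: "affine_map \<epsilon> c = affine_map \<delta> d"
  shows "\<epsilon> = \<delta>" "c - d \<in> holonomy_group \<beta>"
proof -
  have mem: "(\<epsilon> y + c) - (\<delta> y + d) \<in> holonomy_group \<beta>" for y
  proof -
    have "\<pi> (\<epsilon> y + c) = \<pi> (\<delta> y + d)"
      using affine_map_apply[OF assms(1), of c y] affine_map_apply[OF assms(2), of d y] eq by simp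
    then show ?thesis
      by (simp only: proj_eq_iff)
  qed
  have "\<epsilon> 0 = 0" "\<delta> 0 = 0"
    using assms(1,2) by auto
  then show cd: "c - d \<in> holonomy_group \<beta>"
    using mem[of 0] by simp
  show "\<epsilon> = \<delta>"
  proof (rule ccontr)
    assume "\<epsilon> \<noteq> \<delta>"
    have diff: "\<epsilon> y - \<delta> y \<in> holonomy_group \<beta>" for y
      using additive_subgroup_diff[OF subgroup_holonomy_group mem[of y] cd]
      by (simp add: algebra_simps)
    have "y \<in> holonomy_group \<beta>" for y
    proof -
      have half: "y /\<^sub>R 2 + y /\<^sub>R 2 = y"
        by (simp flip: scaleR_add_left)
      consider "\<epsilon> = id" "\<delta> = uminus" | "\<epsilon> = uminus" "\<delta> = id"
        using assms(1,2) \<open>\<epsilon> \<noteq> \<delta>\<close> by blast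
      then show ?thesis
      proof cases
        case 1
        then show ?thesis using diff[of "y /\<^sub>R 2"] half by simp
      next
        case 2
        then show ?thesis using diff[of "- (y /\<^sub>R 2)"] half by simp
      qed
    qed
    then have "countable (UNIV :: (real^'n) set)"
      by (intro countable_subset[OF _ countable_holonomy_group[of \<beta>]]) blast
    moreover have "uncountable (ball (0 :: real^'n) 1)"
      by (rule uncountable_ball) simp
    ultimately show False
      using countable_subset[of "ball (0 :: real^'n) 1" UNIV] by simp
  qed
qed

lemma differentiable_map_lift:
  assumes "differentiable_map (range \<pi>) (quotient_of_std \<pi>) (range \<pi>) (quotient_of_std \<pi>) f"
  obtains A c where "linear A" "A ` holonomy_group \<beta> \<subseteq> holonomy_group \<beta>" "\<And>y. f (\<pi> y) = \<pi> (A y + c)"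
  by (rule differentiable_map_affine_lift[OF assms subgroup_holonomy_group countable_holonomy_group
        holonomy_group_dense[OF nonquadratic] proj_eq_iff]) (rule that)

text \<open>Both \<open>f\<close> and its inverse have affine lifts. The composite lift minus the
  identity is continuous with values in \<Gamma>, hence constant, so the linear parts are mutually
  inverse and the linear part of \<open>f\<close> is a sign.\<close>

lemma diffeomorphism_imp_affine_map:
  assumes f: "f \<in> Bij (range \<pi>)"
    and diffeo: "diffeomorphism (range \<pi>) (quotient_of_std \<pi>) (range \<pi>) (quotient_of_std \<pi>) f"
  obtains \<epsilon> c where "\<epsilon> \<in> {id, uminus}" "f = affine_map \<epsilon> c"
proof -
  let ?g = "inv_into (range \<pi>) f"
  obtain A c where A: "linear A" "A ` holonomy_group \<beta> \<subseteq> holonomy_group \<beta>" "\<And>y. f (\<pi> y) = \<pi> (A y + c)"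
    by (rule differentiable_map_lift[of f]) (use diffeo in \<open>simp add: diffeomorphism_def\<close>, rule that)
  obtain B d where B: "linear B" "B ` holonomy_group \<beta> \<subseteq> holonomy_group \<beta>" "\<And>y. ?g (\<pi> y) = \<pi> (B y + d)"
    by (rule differentiable_map_lift[of ?g]) (use diffeo in \<open>simp add: diffeomorphism_def\<close>, rule that)
  have mem: "A (B y + d) + c - y \<in> holonomy_group \<beta>" for y
  proof -
    have "f (?g (\<pi> y)) = \<pi> y"
      using f bij_betw_inv_into_right[of f "range \<pi>" "range \<pi>" "\<pi> y"] by (simp add: Bij_def)
    then show ?thesis
      by (simp only: A(3) B(3) proj_eq_iff)
  qed
  have cont: "continuous_on UNIV (\<lambda>y. A (B y + d) + c - y)"
    by (intro continuous_intros linear_continuous_on_compose[OF _ A(1)] linear_continuous_on_compose[OF _ B(1)])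
  have "countable (range (\<lambda>y. A (B y + d) + c - y))"
    by (rule countable_subset[OF _ countable_holonomy_group[of \<beta>]]) (use mem in blast)
  then have "A (B y + d) + c - y = A (B 0 + d) + c - 0" for y
    by (rule continuous_countable_range_constant[OF connected_UNIV cont]) auto
  then have "A (B y) = y" for y
    using linear_add[OF A(1)] linear_0[OF A(1)] linear_0[OF B(1)] by (simp add: algebra_simps)
  then have "A = id \<or> A = uminus"
    by (rule linear_inverse_pair_sign[OF nonquadratic A(1) B(1) A(2) B(2)])
  then have A_sign: "A \<in> {id, uminus}"
    by simp
  moreover have "f = affine_map A c"
  proof (rule extensionalityI[of _ "range \<pi>"])
    show "f P = affine_map A c P" if "P \<in> range \<pi>" for P
      using that affine_map_apply[OF A_sign] A(3) by auto
  qed (use f in \<open>simp_all add: Bij_def affine_map_def\<close>)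
  ultimately show ?thesis
    using that by blast
qed

text \<open>Sending (\<epsilon>, c + \<Gamma>) to the map induced by y |-> \<epsilon> y + c is
  multiplicative, because composition has translation part c + \<epsilon> d. The isomorphism is
  built in this direction and inverted at the end.\<close>

lemma Diff_group_iso_semidirect_product:
  "Diff_group (range \<pi>) (quotient_of_std \<pi>)
    \<cong> semidirect_product sign_group (holonomy_quotient \<beta>) (\<lambda>\<epsilon> C. \<epsilon> ` C)"
proof (rule iso_inverse_is_iso)
  let ?S = "semidirect_product sign_group (holonomy_quotient \<beta>) (\<lambda>\<epsilon> C. \<epsilon> ` C)
    :: ((real^'n \<Rightarrow> real^'n) \<times> (real^'n) set) monoid"
  let ?D = "Diff_group (range \<pi>) (quotient_of_std \<pi>)"
  let ?coset = "\<lambda>c. holonomy_group \<beta> #>\<^bsub>additive_group\<^esub> c"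
  \<comment> \<open>Representatives of one coset induce the same map by
    \<open>affine_map_cong\<close>, so the choice is harmless.\<close>
  define h where "h = (\<lambda>(\<epsilon>, C). affine_map \<epsilon> (SOME c. c \<in> C))"
  have carrier_S: "carrier ?S = {(\<epsilon>, ?coset c) | \<epsilon> c. \<epsilon> \<in> {id, uminus}}"
    by (auto simp: semidirect_product_def sign_group_def holonomy_quotient_def carrier_FactGroup)
  have image: "\<epsilon> ` ?coset c = ?coset (\<epsilon> c)" if "\<epsilon> \<in> {id, uminus}" for \<epsilon> c
  proof (cases "\<epsilon> = id")
    case False
    then have \<epsilon>: "\<epsilon> = uminus" using that by simp
    have "x \<in> uminus ` ?coset c \<longleftrightarrow> x \<in> ?coset (- c)" for x
    proof -
      have "x \<in> uminus ` ?coset c \<longleftrightarrow> - x \<in> ?coset c"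
        by (metis image_iff minus_minus)
      also have "\<dots> \<longleftrightarrow> - (x + c) \<in> holonomy_group \<beta>"
        by (simp only: mem_additive_coset minus_add_distrib diff_conv_add_uminus)
      also have "\<dots> \<longleftrightarrow> x + c \<in> holonomy_group \<beta>"
        using \<Gamma>_sub by (metis minus_minus)
      finally show ?thesis
        by (simp add: mem_additive_coset)
    qed
    then show ?thesis by (simp add: \<epsilon> set_eq_iff)
  qed simp
  have mult_S: "(\<epsilon>, ?coset c) \<otimes>\<^bsub>?S\<^esub> (\<delta>, ?coset d) = (\<epsilon> \<circ> \<delta>, ?coset (c + \<epsilon> d))"
    if "\<epsilon> \<in> {id, uminus}" for \<epsilon> \<delta> c d
    using that
    by (simp add: semidirect_product_def sign_group_def holonomy_quotient_def FactGroup_def image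
        set_mult_additive_coset[OF subgroup_holonomy_group])
  have comp: "\<epsilon> \<circ> \<delta> \<in> {id, uminus}" if "\<epsilon> \<in> {id, uminus}" "\<delta> \<in> {id, uminus}" for \<epsilon> \<delta> :: "real^'n \<Rightarrow> real^'n"
    using that by (auto simp: fun_eq_iff)
  show "x \<otimes>\<^bsub>?S\<^esub> y \<in> carrier ?S" if xy: "x \<in> carrier ?S" "y \<in> carrier ?S" for x y
  proof -
    obtain \<epsilon> c \<delta> d where x: "x = (\<epsilon>, ?coset c)" "\<epsilon> \<in> {id, uminus}" and y: "y = (\<delta>, ?coset d)" "\<delta> \<in> {id, uminus}"
      using xy unfolding carrier_S by blast
    show ?thesis
      unfolding x(1) y(1) mult_S[OF x(2)] carrier_S using comp[OF x(2) y(2)] by blast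
  qed
  have h: "h (\<epsilon>, ?coset c) = affine_map \<epsilon> c" for \<epsilon> c
  proof -
    have "c \<in> ?coset c"
      using \<Gamma>_sub by (simp add: mem_additive_coset)
    then have "(SOME c'. c' \<in> ?coset c) \<in> ?coset c"
      by (rule someI)
    then show ?thesis
      by (simp add: h_def mem_additive_coset affine_map_cong)
  qed
  have aff_Bij: "affine_map \<epsilon> c \<in> Bij (range \<pi>)" if "\<epsilon> \<in> {id, uminus}" for \<epsilon> c
    using affine_map_diffeomorphism[OF that, of c]
    by (simp add: Bij_def diffeomorphism_def affine_map_def)
  have carrier_D: "carrier ?D = {affine_map \<epsilon> c | \<epsilon> c. \<epsilon> \<in> {id, uminus}}"
  proof (intro equalityI subsetI)
    fix f assume "f \<in> carrier ?D"
    then show "f \<in> {affine_map \<epsilon> c | \<epsilon> c. \<epsilon> \<in> {id, uminus}}"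
      using diffeomorphism_imp_affine_map[of f] by (simp add: Diff_group_def) blast
  next
    fix f assume "f \<in> {affine_map \<epsilon> c | \<epsilon> c. \<epsilon> \<in> {id, uminus}}"
    then obtain \<epsilon> c where f: "f = affine_map \<epsilon> c" "\<epsilon> \<in> {id, uminus}"
      by blast
    show "f \<in> carrier ?D"
      unfolding f(1) using affine_map_diffeomorphism[OF f(2)] aff_Bij[OF f(2)]
      by (simp add: Diff_group_def)
  qed
  have mult_D: "affine_map \<epsilon> c \<otimes>\<^bsub>?D\<^esub> affine_map \<delta> d = affine_map (\<epsilon> \<circ> \<delta>) (c + \<epsilon> d)"
    if "\<epsilon> \<in> {id, uminus}" "\<delta> \<in> {id, uminus}" for \<epsilon> \<delta> c d
    using aff_Bij[OF that(1)] aff_Bij[OF that(2)] affine_map_compose[OF that]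
    by (simp add: Diff_group_def BijGroup_def)
  show "h \<in> iso ?S ?D"
    unfolding iso_iff
  proof (intro conjI)
    show "h \<in> hom ?S ?D"
      unfolding hom_def
    proof (intro CollectI conjI ballI funcsetI)
      fix x assume "x \<in> carrier ?S"
      then obtain \<epsilon> c where x: "x = (\<epsilon>, ?coset c)" "\<epsilon> \<in> {id, uminus}"
        unfolding carrier_S by blast
      then show "h x \<in> carrier ?D"
        unfolding carrier_D x(1) h by blast
      fix y assume "y \<in> carrier ?S"
      then obtain \<delta> d where y: "y = (\<delta>, ?coset d)" "\<delta> \<in> {id, uminus}"
        unfolding carrier_S by blast
      show "h (x \<otimes>\<^bsub>?S\<^esub> y) = h x \<otimes>\<^bsub>?D\<^esub> h y"
        unfolding x(1) y(1) mult_S[OF x(2)] h mult_D[OF x(2) y(2)] ..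
    qed
    show "h ` carrier ?S = carrier ?D"
    proof (intro equalityI subsetI)
      fix f assume "f \<in> carrier ?D"
      then obtain \<epsilon> c where f: "f = affine_map \<epsilon> c" "\<epsilon> \<in> {id, uminus}"
        unfolding carrier_D by blast
      show "f \<in> h ` carrier ?S"
        by (rule image_eqI[of _ _ "(\<epsilon>, ?coset c)"]) (use f in \<open>auto simp: h carrier_S\<close>)
    next
      fix f assume "f \<in> h ` carrier ?S"
      then obtain \<epsilon> c where "f = h (\<epsilon>, ?coset c)" "\<epsilon> \<in> {id, uminus}"
        unfolding carrier_S by blast
      then show "f \<in> carrier ?D"
        unfolding carrier_D h by blast
    qed
    show "inj_on h (carrier ?S)"
    proof (rule inj_onI)
      fix x y assume xy: "x \<in> carrier ?S" "y \<in> carrier ?S" and eq: "h x = h y"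
      obtain \<epsilon> c \<delta> d where x: "x = (\<epsilon>, ?coset c)" "\<epsilon> \<in> {id, uminus}" and y: "y = (\<delta>, ?coset d)" "\<delta> \<in> {id, uminus}"
        using xy unfolding carrier_S by blast
      have "affine_map \<epsilon> c = affine_map \<delta> d"
        using eq unfolding x(1) y(1) h .
      from affine_map_inj[OF x(2) y(2) this] show "x = y"
        by (simp add: x(1) y(1) additive_coset_eq_iff[OF subgroup_holonomy_group])
    qed
  qed
qed

end

section \<open>Leaves described by the values of \<omega>\<close>

text \<open>Representatives of a torus point differ by lattice vectors, which
  \<open>torus_proj\<close> ignores, so a single one suffices.\<close>

lemma leaf_torus_proj:
  assumes "subspace V"
  shows "leaf V (torus_proj z) = (\<lambda>v. torus_proj (z + v)) ` V"
proof (intro equalityI subsetI)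
  fix P assume "P \<in> leaf V (torus_proj z)"
  then obtain z' v where P: "P = torus_proj (z' + v)" "z' \<in> torus_proj z" "v \<in> V"
    unfolding leaf_def by blast
  then have "torus_proj (z' + v) = torus_proj (z + v)"
    unfolding torus_proj_def by (simp add: additive_coset_eq_iff[OF subgroup_int_lattice] mem_additive_coset)
  with P show "P \<in> (\<lambda>v. torus_proj (z + v)) ` V"
    by blast
next
  fix P assume "P \<in> (\<lambda>v. torus_proj (z + v)) ` V"
  moreover have "z \<in> torus_proj z"
    by (simp add: torus_proj_def mem_additive_coset int_lattice_def zero_prod_def)
  ultimately show "P \<in> leaf V (torus_proj z)"
    unfolding leaf_def by blast
qed

text \<open>The union of the leaf is z + V plus the lattice; \<omega> vanishes on V and maps the
  lattice onto \<Gamma>.\<close>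

lemma leaf_identification_leaf:
  assumes V: "subspace V" "V = {z. foliation_form \<beta> z = 0}"
  shows "leaf_identification \<beta> (leaf V (torus_proj z))
    = holonomy_group \<beta> #>\<^bsub>additive_group\<^esub> foliation_form \<beta> z"
proof -
  interpret \<omega>: linear "foliation_form \<beta>" by (rule linear_foliation_form)
  show ?thesis
  proof (intro equalityI subsetI)
    fix y assume "y \<in> leaf_identification \<beta> (leaf V (torus_proj z))"
    then obtain v w where vw: "v \<in> V" "w \<in> torus_proj (z + v)" "y = foliation_form \<beta> w"
      unfolding leaf_identification_def leaf_torus_proj[OF V(1)] by blast
    then have "w - (z + v) \<in> int_lattice"
      by (simp add: torus_proj_def mem_additive_coset)
    then have "foliation_form \<beta> (w - (z + v)) \<in> holonomy_group \<beta>"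
      unfolding holonomy_group_eq by (rule imageI)
    then show "y \<in> holonomy_group \<beta> #>\<^bsub>additive_group\<^esub> foliation_form \<beta> z"
      using vw V(2) by (simp add: mem_additive_coset \<omega>.diff \<omega>.add)
  next
    fix y assume "y \<in> holonomy_group \<beta> #>\<^bsub>additive_group\<^esub> foliation_form \<beta> z"
    then have "y - foliation_form \<beta> z \<in> foliation_form \<beta> ` int_lattice"
      by (simp add: mem_additive_coset holonomy_group_eq)
    then obtain l where l: "l \<in> int_lattice" "y - foliation_form \<beta> z = foliation_form \<beta> l"
      by blast
    then have "y = foliation_form \<beta> (z + l)"
      by (simp add: \<omega>.add algebra_simps)
    moreover have "z + l \<in> torus_proj (z + 0)"
      using l(1) by (simp add: torus_proj_def mem_additive_coset)
    moreover have "0 \<in> V"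
      using V(1) by (rule subspace_0)
    ultimately show "y \<in> leaf_identification \<beta> (leaf V (torus_proj z))"
      unfolding leaf_identification_def leaf_torus_proj[OF V(1)] by blast
  qed
qed

text \<open>Equal leaves have equal cosets under \<open>leaf_identification\<close>. Conversely, if
  \<omega>(a) - \<omega>(b) = \<omega>(l) with l in the lattice, then a - b - l lies in V, so the
  leaf of a is contained in that of b; symmetry gives equality.\<close>

lemma leaf_eq_iff:
  assumes V: "subspace V" "V = {z. foliation_form \<beta> z = 0}"
  shows "leaf V (torus_proj z) = leaf V (torus_proj z') \<longleftrightarrow>
    foliation_form \<beta> z - foliation_form \<beta> z' \<in> holonomy_group \<beta>"
proof
  assume "leaf V (torus_proj z) = leaf V (torus_proj z')"
  then show "foliation_form \<beta> z - foliation_form \<beta> z' \<in> holonomy_group \<beta>"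
    using leaf_identification_leaf[OF V] additive_coset_eq_iff[OF subgroup_holonomy_group] by metis
next
  interpret \<omega>: linear "foliation_form \<beta>" by (rule linear_foliation_form)
  have sub: "leaf V (torus_proj a) \<subseteq> leaf V (torus_proj b)"
    if "foliation_form \<beta> a - foliation_form \<beta> b \<in> holonomy_group \<beta>" for a b
  proof -
    from that obtain l where l: "l \<in> int_lattice" "foliation_form \<beta> a - foliation_form \<beta> b = foliation_form \<beta> l"
      unfolding holonomy_group_eq by blast
    then have "a - b - l \<in> V"
      by (simp add: V(2) \<omega>.diff)
    then have "a - b - l + v \<in> V" if "v \<in> V" for v
      using subspace_add[OF V(1)] that by blast
    moreover have "torus_proj (a + v) = torus_proj (b + (a - b - l + v))" for v
      using l(1) unfolding torus_proj_def additive_coset_eq_iff[OF subgroup_int_lattice] by simp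
    ultimately show ?thesis
      unfolding leaf_torus_proj[OF V(1)] by blast
  qed
  assume mem: "foliation_form \<beta> z - foliation_form \<beta> z' \<in> holonomy_group \<beta>"
  then have "- (foliation_form \<beta> z - foliation_form \<beta> z') \<in> holonomy_group \<beta>"
    using subgroup_holonomy_group[of \<beta>] unfolding additive_subgroup_iff by blast
  then show "leaf V (torus_proj z) = leaf V (torus_proj z')"
    using sub[OF mem] sub[of z' z] by simp
qed

theorem theorem8p7:
  fixes V :: "((real^'m) \<times> (real^'n)) set"
    and \<beta> :: "real^'m^'n"
  assumes "linear_foliation V"
    and "nonquadratic_form \<beta> V"
  shows "carrier (linear_aut_group (holonomy_group \<beta>)) = {id, uminus}
    \<and> diffeomorphism (leaf_space V) (leaf_space_diffeology V)
        (carrier (holonomy_quotient \<beta>)) (holonomy_quotient_diffeology \<beta>) (leaf_identification \<beta>)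
    \<and> Diff_group (leaf_space V) (leaf_space_diffeology V)
        \<cong> semidirect_product sign_group (holonomy_quotient \<beta>) (\<lambda>\<epsilon> C. \<epsilon> ` C)"
proof -
  have V: "subspace V" "V = {z. foliation_form \<beta> z = 0}" and nonquadratic: "nonquadratic_coeffs \<beta>"
    using assms by (simp_all add: linear_foliation_def nonquadratic_form_def)
  define \<pi> where "\<pi> z = leaf V (torus_proj z)" for z
  define \<rho> where "\<rho> y = holonomy_group \<beta> #>\<^bsub>additive_group\<^esub> y" for y
  \<comment> \<open>\<open>\<sigma>\<close> parametrises the leaves by the transversal x = 0, a copy
    of the space on which \<Gamma> acts.\<close>
  define \<sigma> where "\<sigma> y = \<pi> (0, y)" for y
  have form0: "foliation_form \<beta> (0, y) = y" for y
    by (simp add: foliation_form_alt)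
  have lin0: "linear (\<lambda>y :: real^'n. (0 :: real^'m, y))"
    by (rule linearI) simp_all
  have \<pi>_eq: "\<pi> z = \<pi> z' \<longleftrightarrow> foliation_form \<beta> z - foliation_form \<beta> z' \<in> holonomy_group \<beta>" for z z'
    unfolding \<pi>_def by (rule leaf_eq_iff[OF V])
  have \<rho>_eq: "\<rho> x = \<rho> y \<longleftrightarrow> x - y \<in> holonomy_group \<beta>" for x y
    unfolding \<rho>_def by (rule additive_coset_eq_iff[OF subgroup_holonomy_group])
  have "range torus_proj = (torus :: ((real^'m) \<times> (real^'n)) set set)"
    unfolding torus_def carrier_FactGroup torus_proj_def by simp
  then have space: "leaf_space V = range \<pi>"
    unfolding leaf_space_def \<pi>_def by (metis image_image)
  have diffeology: "leaf_space_diffeology V = quotient_of_std \<pi>"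
    unfolding leaf_space_diffeology_def torus_diffeology_def quotient_quotient_diffeology \<pi>_def ..
  have quotient: "carrier (holonomy_quotient \<beta>) = range \<rho>" "holonomy_quotient_diffeology \<beta> = quotient_of_std \<rho>"
    unfolding holonomy_quotient_def holonomy_quotient_diffeology_def carrier_FactGroup \<rho>_def by simp_all
  have ident: "leaf_identification \<beta> (\<pi> z) = \<rho> (foliation_form \<beta> z)" for z
    unfolding \<pi>_def \<rho>_def by (rule leaf_identification_leaf[OF V])
  have inj: "inj_on (leaf_identification \<beta>) (range \<pi>)"
    by (rule inj_onI, elim rangeE) (simp only: ident \<rho>_eq \<pi>_eq)
  have inv: "inv_into (range \<pi>) (leaf_identification \<beta>) (\<rho> y) = \<pi> (0, y)" for y
    by (rule inv_into_f_eq[OF inj]) (simp_all add: ident form0)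
  have "diffeomorphism (range \<pi>) (quotient_of_std \<pi>) (range \<rho>) (quotient_of_std \<rho>) (leaf_identification \<beta>)"
  proof (rule diffeomorphism_affine[where L = "foliation_form \<beta>" and c = 0
        and M = "\<lambda>y. (0, y)" and d = 0 and G = "inv_into (range \<pi>) (leaf_identification \<beta>)"])
    show "inv_into (range \<pi>) (leaf_identification \<beta>) (leaf_identification \<beta> (\<pi> z)) = \<pi> z" for z
      using inj by (simp add: inv_into_f_f)
  qed (simp_all add: linear_foliation_form lin0 ident inv form0)
  \<comment> \<open>The points \<open>z\<close> and \<open>(0, foliation_form \<beta> z)\<close>
    have the same value under \<omega>, so they lie on the same leaf.\<close>
  moreover have \<pi>\<sigma>: "\<pi> z = \<sigma> (foliation_form \<beta> z)" for z
    using subgroup_holonomy_group[of \<beta>] by (simp add: \<sigma>_def \<pi>_eq form0 additive_subgroup_iff)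
  have "range \<pi> = range \<sigma>"
    using \<pi>\<sigma> unfolding \<sigma>_def by blast
  moreover have "quotient_of_std \<pi> = quotient_of_std \<sigma>"
    by (rule quotient_of_std_eqI[where \<pi> = \<pi> and \<rho> = \<sigma> and L = "foliation_form \<beta>"
          and M = "\<lambda>y. (0, y)", OF linear_foliation_form lin0 \<pi>\<sigma>]) (simp only: \<sigma>_def)
  \<comment> \<open>With \<open>\<sigma>\<close> as projection, the group isomorphism is obtained on
    the leaf space itself and needs no transport along \<open>leaf_identification\<close>.\<close>
  moreover have "holonomy_projection \<beta> \<sigma>"
    by unfold_locales (simp_all add: nonquadratic \<sigma>_def \<pi>_eq form0)
  ultimately show ?thesis
    using linear_aut_holonomy_group[OF nonquadratic] holonomy_projection.Diff_group_iso_semidirect_product[of \<beta> \<sigma>]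
    by (simp add: space diffeology quotient)
qed

end
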